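(* For $0<\sigma<1$, $t>0$ and $0<\delta_2<1$ let $$I_2(\sigma,t,\delta_2)=\frac{t}{\pi}\int_{1/t}^{t^{\delta_2-1}}\Re\left\{\frac{\Gamma(it-it\tau)}{\Gamma(\sigma+it)}\,\Gamma(\sigma+it\tau)\right\}|\zeta(\sigma+it\tau)|^2\,d\tau.$$ Then $$I_2\left(\tfrac12,t,\delta_2\right)=O\left(t^{-\frac12+\delta_2}\ln t\right),\qquad t\to\infty,$$ and $$I_2(\sigma,t,\delta_2)=\begin{cases}O\left(t^{-\sigma+\left(\sigma+\frac12\right)\delta_2}\,\zeta(2\sigma)\right), & \frac12<\sigma<1,\ t\to\infty,\\[1mm] O\left(t^{-\sigma+2(1-\sigma)\delta_2}\,\zeta(2-2\sigma)\right), & 0<\sigma<\frac12,\ t\to\infty.\end{cases}$$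
   Context: $\Gamma$ is the gamma function and $\zeta$ the Riemann zeta function (analytically continued). *)

theory Defs
  imports "HOL-Complex_Analysis.Complex_Analysis" "HOL-Library.Landau_Symbols"
begin

text \<open>
  The Riemann zeta function is the analytic continuation to the complex plane without 1
  of the Dirichlet series \<open>\<Sum> n\<ge>1. n\<^sup>-\<^sup>s\<close>. The continuation does not determine a value at the
  pole 1; the clause \<^term>\<open>f 1 = 0\<close> fixes one, so that the description is unique.
\<close>

definition zeta :: "complex \<Rightarrow> complex" where
  "zeta = (THE f. f holomorphic_on (- {1}) \<and>
                  (\<forall>s. Re s > 1 \<longrightarrow> f s = (\<Sum>n. 1 / of_nat (Suc n) powr s)) \<and>
                  f 1 = 0)"

text \<open>
  The interval integral is oriented, so the definition also has its usual meaning for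
  \<open>0 < t < 1\<close>, where the lower limit exceeds the upper one.
\<close>

definition I2 :: "real \<Rightarrow> real \<Rightarrow> real \<Rightarrow> real" where
  "I2 \<sigma> t \<delta>\<^sub>2 = t / pi *
     (LBINT \<tau>=ereal (1 / t)..ereal (t powr (\<delta>\<^sub>2 - 1)).
        Re (Gamma (\<i> * of_real t - \<i> * of_real t * of_real \<tau>) / Gamma (of_real \<sigma> + \<i> * of_real t)
            * Gamma (of_real \<sigma> + \<i> * of_real t * of_real \<tau>))
        * (cmod (zeta (of_real \<sigma> + \<i> * of_real t * of_real \<tau>)))\<^sup>2)"

end

theory Submission
  imports Defs
begin

text \<open>
  The substitution \<open>s = t\<tau>\<close> turns \<open>I\<^sub>2\<close> into an integral over \<open>1 \<le> s \<le> t\<^sup>\<delta>\<close>. On that range \<open>s\<close> is small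
  against \<open>t\<close>, so the exponential factors of the three Gamma values cancel and the quotient is
  \<open>O(t\<^sup>-\<^sup>\<sigma> s\<^sup>\<sigma>\<^sup>-\<^sup>1\<^sup>/\<^sup>2)\<close> (\<open>Gamma_ratio_bound\<close>). Everything is therefore reduced to the size of
  \<open>\<integral> s\<^sup>\<sigma>\<^sup>-\<^sup>1\<^sup>/\<^sup>2 \<bar>\<zeta>(\<sigma> + is)\<bar>\<^sup>2 ds\<close> over \<open>[1, T]\<close> with \<open>T = t\<^sup>\<delta>\<close>. The factors \<open>\<zeta>(2\<sigma>)\<close> and \<open>\<zeta>(2 - 2\<sigma>)\<close> in the
  bounds are positive constants (\<open>Re_zeta_of_real_pos\<close>).

  For the Gamma function it is enough to know its modulus on the imaginary axis, where the
  reflection formula gives it exactly, and to interpolate between the lines \<open>Re z = 0\<close> and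
  \<open>Re z = 1\<close> (\<open>Gamma_interpolation\<close>). A lower bound inside the strip then follows from the upper
  bound by reflection.

  For the zeta function the alternating series \<open>\<eta>(s) = (1 - 2\<^sup>1\<^sup>-\<^sup>s) \<zeta>(s)\<close> plays the main role. Replacing
  an alternating series by the series of the means of consecutive terms takes half of its first
  term away and improves its convergence by one power of \<open>n\<close>, and repeated averaging continues \<open>\<eta>\<close>
  to the whole plane. The same averaging, started at \<open>N = 2\<^sup>K\<close> and repeated \<open>K\<close> times, shows that \<open>\<eta>(s)\<close>
  differs from its partial sum up to \<open>N\<close> by \<open>O(N\<^sup>-\<^sup>\<sigma>)\<close> once \<open>\<bar>s\<bar> + K \<le> N\<close> (\<open>cmod_eta_tail_le\<close>). This
  stands in for an approximate functional equation, and since \<open>\<bar>1 - 2\<^sup>1\<^sup>-\<^sup>s\<bar>\<close> is bounded below on every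
  line \<open>Re s = \<sigma> < 1\<close>, it leaves the mean square of a Dirichlet polynomial of length comparable to \<open>T\<close>.
  That is bounded by integrating the double sum
  term by term (\<open>dirichlet_polynomial_mean_square\<close>).

  The resulting bounds for \<open>\<integral> \<bar>\<zeta>(\<sigma> + iy)\<bar>\<^sup>2 dy\<close> are \<open>O(T)\<close> for \<open>\<sigma> > 1/2\<close> and \<open>O(T\<^sup>2\<^sup>-\<^sup>2\<^sup>\<sigma> ln T)\<close> for
  \<open>\<sigma> \<le> 1/2\<close>. At \<open>\<sigma> = 1/2\<close> the logarithm is the one in the theorem. For \<open>\<sigma> < 1/2\<close> it is absorbed by
  the decay of the weight \<open>s\<^sup>\<sigma>\<^sup>-\<^sup>1\<^sup>/\<^sup>2\<close> (\<open>weighted_mean_square_left\<close>).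
\<close>

section \<open>The Gamma function on vertical lines\<close>

text \<open>
  The square of \<open>\<bar>u + iy\<bar>\<close> is a quadratic polynomial in \<open>u\<close> with leading coefficient 1, so its linear
  interpolation between \<open>k\<close> and \<open>k + 1\<close> exceeds its value at \<open>k + x\<close> by exactly \<open>x(1 - x)\<close>. The weighted
  inequality between geometric and arithmetic means turns this into a bound for the geometric
  interpolation with relative error \<open>O(1/\<bar>k + x + iy\<bar>\<^sup>2)\<close>.
\<close>

lemma cmod_interpolation:
  fixes x y k :: real
  assumes x: "0 \<le> x" "x \<le> 1" and y: "y \<noteq> 0"
  shows "cmod (Complex k y) powr (1 - x) * cmod (Complex (k + 1) y) powr x
    \<le> exp (1 / (8 * y\<^sup>2 + 8 * (k + x)\<^sup>2)) * cmod (Complex (k + x) y)"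
proof -
  define u where "u = k\<^sup>2 + y\<^sup>2"
  define v where "v = (k + 1)\<^sup>2 + y\<^sup>2"
  define w where "w = (k + x)\<^sup>2 + y\<^sup>2"
  have pos: "u > 0" "v > 0" "w > 0"
    using y by (simp_all add: u_def v_def w_def add_nonneg_pos)
  have "u powr (1 - x) * v powr x \<le> (1 - x) * u + x * v"
    using Youngs_inequality_0[of "1 - x" x u v] x pos by simp
  \<comment> \<open>The excess of the chord over the parabola.\<close>
  also have "\<dots> = w + x * (1 - x)"
    by (simp add: u_def v_def w_def power2_eq_square algebra_simps)
  also have "x * (1 - x) \<le> 1 / 4"
    using zero_le_power2[of "x - 1 / 2"] by (simp add: power2_eq_square algebra_simps)
  also have "w + 1 / 4 = w * (1 + 1 / (4 * w))"
    using pos by (simp add: field_simps)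
  also have "\<dots> \<le> w * exp (1 / (4 * w))"
    using pos exp_ge_add_one_self[of "1 / (4 * w)"] by (intro mult_left_mono) auto
  finally have le: "u powr (1 - x) * v powr x \<le> w * exp (1 / (4 * w))" by simp
  have "sqrt u powr (1 - x) * sqrt v powr x = sqrt (u powr (1 - x) * v powr x)"
    using pos by (simp add: real_sqrt_mult powr_half_sqrt[symmetric] powr_powr mult.commute)
  also have "\<dots> \<le> sqrt (w * exp (1 / (4 * w)))"
    using le by simp
  also have "\<dots> = sqrt w * exp (1 / (8 * w))"
    using exp_double[of "1 / (8 * w)"] by (simp add: real_sqrt_mult)
  finally show ?thesis
    by (simp add: u_def v_def w_def cmod_def mult.commute algebra_simps)
qed

text \<open>
  The product of the previous estimates over \<open>k < m\<close>. The shifted product \<open>\<Prod> \<bar>k + 1 + iy\<bar>\<close> telescopes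
  against \<open>\<Prod> \<bar>k + iy\<bar>\<close>, and the quotient \<open>\<bar>m + iy\<bar>/y\<close> is what remains of it. The relative errors stay
  bounded because the sum of \<open>1/(1 + k\<^sup>2)\<close> converges.
\<close>

lemma pochhammer_interpolation:
  fixes x y :: real
  assumes x: "0 \<le> x" "x \<le> 1" and y: "y \<ge> 1"
  shows "cmod (pochhammer (Complex 0 y) m) * (cmod (Complex (real m) y) / y) powr x
    \<le> exp (\<Sum>k<m. 1 / (1 + (real k)\<^sup>2)) * cmod (pochhammer (Complex x y) m)"
proof (induction m)
  case 0
  then show ?case using y by (simp add: cmod_def)
next
  case (Suc m)
  define a where "a = cmod (Complex (real m) y)"
  define b where "b = cmod (Complex (real m + 1) y)"
  define d where "d = cmod (Complex (real m + x) y)"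
  have pos: "a > 0" "b > 0" using y by (auto simp: a_def b_def complex_eq_iff)
  have "1 / (8 * y\<^sup>2 + 8 * (real m + x)\<^sup>2) \<le> 1 / (1 + (real m)\<^sup>2)"
  proof (rule divide_left_mono)
    have "(real m)\<^sup>2 \<le> (real m + x)\<^sup>2" using x by (intro power_mono) auto
    moreover have "1 \<le> y\<^sup>2" using y by simp
    ultimately show "1 + (real m)\<^sup>2 \<le> 8 * y\<^sup>2 + 8 * (real m + x)\<^sup>2" 
      using zero_le_power2[of "real m + x"] by linarith
  qed (use y in \<open>auto intro!: mult_pos_pos add_pos_nonneg\<close>)
  then have step: "a powr (1 - x) * b powr x \<le> exp (1 / (1 + (real m)\<^sup>2)) * d"
    using cmod_interpolation[OF x, of y "real m"] y unfolding a_def b_def d_def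
    by (smt (verit, best) exp_le_cancel_iff mult_right_mono norm_ge_zero)
  have "cmod (pochhammer (Complex 0 y) (Suc m)) * (cmod (Complex (real (Suc m)) y) / y) powr x
      = (cmod (pochhammer (Complex 0 y) m) * (a / y) powr x) * (a powr (1 - x) * b powr x)"
  proof -
    have "Complex 0 y + of_nat m = Complex (real m) y" by (simp add: complex_eq_iff)
    moreover have "a * (b / y) powr x = (a / y) powr x * (a powr (1 - x) * b powr x)"
      using pos y by (simp add: powr_divide powr_diff)
    ultimately show ?thesis
      by (simp add: pochhammer_Suc norm_mult a_def b_def add.commute)
  qed
  also have "\<dots> \<le> (exp (\<Sum>k<m. 1 / (1 + (real k)\<^sup>2)) * cmod (pochhammer (Complex x y) m))
      * (exp (1 / (1 + (real m)\<^sup>2)) * d)"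
    by (rule mult_mono[OF Suc.IH[folded a_def] step]) (auto simp: d_def)
  also have "\<dots> = exp (\<Sum>k<Suc m. 1 / (1 + (real k)\<^sup>2)) * cmod (pochhammer (Complex x y) (Suc m))"
  proof -
    have "Complex x y + of_nat m = Complex (real m + x) y" by (simp add: complex_eq_iff)
    then show ?thesis
      by (simp add: pochhammer_Suc norm_mult d_def exp_add)
  qed
  finally show ?case .
qed

lemma summable_inverse_1_plus_squares: "summable (\<lambda>k. 1 / (1 + (real k)\<^sup>2))"
proof (rule summable_comparison_test')
  show "summable (\<lambda>k. inverse (real k ^ 2))"
    by (rule inverse_power_summable) simp
  show "norm (1 / (1 + (real n)\<^sup>2)) \<le> inverse (real n ^ 2)" if "n \<ge> 1" for n
    using that by (auto simp: divide_simps not_less add_nonneg_nonneg)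
qed

text \<open>
  A substitute for Stirling's formula that keeps the right power of \<open>y\<close>: inserting the product estimate
  into Euler's limit formula for Gamma interpolates between \<open>\<bar>\<Gamma>(iy)\<bar>\<close> and \<open>\<bar>\<Gamma>(1 + iy)\<bar> = y \<bar>\<Gamma>(iy)\<bar>\<close>.
\<close>

lemma Gamma_interpolation:
  obtains C :: real where "C > 0"
    "\<And>x y. 0 \<le> x \<Longrightarrow> x \<le> 1 \<Longrightarrow> y \<ge> 1 \<Longrightarrow>
      cmod (Gamma (Complex x y)) \<le> C * (cmod (Gamma (Complex 0 y)) * y powr x)"
proof
  define C where "C = exp (\<Sum>k. 1 / (1 + (real k)\<^sup>2))"
  show "C > 0" by (simp add: C_def)
  fix x y :: real assume x: "0 \<le> x" "x \<le> 1" and y: "y \<ge> 1"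
  show "cmod (Gamma (Complex x y)) \<le> C * (cmod (Gamma (Complex 0 y)) * y powr x)"
  proof (rule tendsto_le[OF sequentially_bot])
    show "(\<lambda>n. cmod (Gamma_series (Complex x y) n)) \<longlonglongrightarrow> cmod (Gamma (Complex x y))"
      by (intro tendsto_intros)
    show "(\<lambda>n. C * (cmod (Gamma_series (Complex 0 y) n) * y powr x))
        \<longlonglongrightarrow> C * (cmod (Gamma (Complex 0 y)) * y powr x)"
      by (intro tendsto_intros)
    show "\<forall>\<^sub>F n in sequentially. cmod (Gamma_series (Complex x y) n)
        \<le> C * (cmod (Gamma_series (Complex 0 y) n) * y powr x)"
    proof (rule eventually_sequentiallyI)
      fix n :: nat assume n: "1 \<le> n"
      define p where "p = cmod (pochhammer (Complex 0 y) (n + 1))"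
      define q where "q = cmod (pochhammer (Complex x y) (n + 1))"
      define r where "r = cmod (Complex (real (n + 1)) y)"
      have nz: "p > 0" "q > 0"
        using y unfolding p_def q_def zero_less_norm_iff pochhammer_eq_0_iff
        by (auto simp: complex_eq_iff)
      have nr: "real n \<le> r"
        using complex_Re_le_cmod[of "Complex (real (n + 1)) y"] by (simp add: r_def)
      have sumle: "exp (\<Sum>k<n + 1. 1 / (1 + (real k)\<^sup>2)) \<le> C"
        unfolding C_def exp_le_cancel_iff
        by (rule sum_le_suminf[OF summable_inverse_1_plus_squares]) auto
      have "p * (r / y) powr x \<le> C * q"
        using pochhammer_interpolation[OF x y, of "n + 1"] sumle
        unfolding p_def q_def r_def
        by (smt (verit, best) mult_right_mono norm_ge_zero)
      moreover have "(real n / y) powr x \<le> (r / y) powr x"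
        using nr x y by (intro powr_mono2 divide_right_mono) auto
      ultimately have "p * (real n / y) powr x \<le> C * q"
        using nz by (smt (verit, best) mult_left_mono)
      then have main: "p * real n powr x \<le> C * q * y powr x"
        using y n by (simp add: powr_divide field_simps)
      have "cmod (Gamma_series (Complex x y) n) = fact n * real n powr x / q"
        using n by (simp add: Gamma_series_def norm_mult norm_divide q_def powr_def mult.commute)
      also have "\<dots> \<le> fact n * (C * y powr x / p)"
        using main nz by (simp add: field_simps)
      also have "\<dots> = C * (cmod (Gamma_series (Complex 0 y) n) * y powr x)"
        using n by (simp add: Gamma_series_def norm_mult norm_divide p_def)
      finally show "cmod (Gamma_series (Complex x y) n)
        \<le> C * (cmod (Gamma_series (Complex 0 y) n) * y powr x)" .
    qed
  qed
qed

text \<open>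
  The reflection formula at \<open>z = iy\<close>, where \<open>\<Gamma>(1 - z) = - z \<Gamma>(- z)\<close> and \<open>\<Gamma>(- z)\<close> is the complex conjugate
  of \<open>\<Gamma>(z)\<close>.
\<close>

lemma cmod_Gamma_imaginary:
  assumes y: "y > 0"
  shows "(cmod (Gamma (Complex 0 y)))\<^sup>2 = pi / (y * sinh (pi * y))"
proof -
  define z where "z = Complex 0 y"
  have z: "z \<notin> \<int>\<^sub>\<le>\<^sub>0" "- z \<notin> \<int>\<^sub>\<le>\<^sub>0" using y
    by (auto simp: z_def elim!: nonpos_Ints_cases simp: complex_eq_iff)
  have "cnj z = - z" by (simp add: z_def complex_eq_iff)
  then have "cmod (Gamma (- z)) = cmod (Gamma z)"
    by (metis complex_mod_cnj cnj_Gamma)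
  moreover have "Gamma (1 - z) = - z * Gamma (- z)"
    using Gamma_plus1[OF z(2)] by simp
  moreover have "cmod z = y" using y by (simp add: z_def cmod_def)
  ultimately have *: "cmod (Gamma (1 - z)) = y * cmod (Gamma z)"
    by (simp add: norm_mult)
  have "sin (of_real pi * z) = \<i> * of_real (sinh (pi * y))"
    by (simp add: z_def complex_eq_iff sin_of_real Re_sin Im_sin sinh_def exp_minus field_simps)
  then have "cmod (sin (of_real pi * z)) = sinh (pi * y)"
    using y by (simp add: norm_mult)
  then have "cmod (Gamma z * Gamma (1 - z)) = pi / sinh (pi * y)"
    by (simp add: Gamma_reflection_complex norm_divide)
  then have "cmod (Gamma z) * (y * cmod (Gamma z)) = pi / sinh (pi * y)"
    by (simp add: norm_mult *)
  then show ?thesis using y by (simp add: z_def power2_eq_square field_simps)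
qed

lemma Gamma_imaginary_le:
  assumes y: "y \<ge> 1"
  shows "cmod (Gamma (Complex 0 y)) \<le> 4 * (y powr (- 1 / 2) * exp (- pi * y / 2))"
proof (rule power2_le_imp_le)
  have "exp (- (pi * y)) \<le> exp (pi * y) / 2"
  proof -
    have "1 \<le> pi * y" using y pi_gt3 by (smt (verit, best) mult_le_cancel_left1)
    then have "2 \<le> exp (pi * y)" using exp_ge_add_one_self[of "pi * y"] by linarith
    moreover have "exp (- (pi * y)) \<le> 1" using y by simp
    ultimately show ?thesis by linarith
  qed
  then have "sinh (pi * y) \<ge> exp (pi * y) / 4"
    by (simp add: sinh_field_def)
  then have "pi / (y * sinh (pi * y)) \<le> pi / (y * (exp (pi * y) / 4))"
    using y by (intro divide_left_mono mult_left_mono mult_pos_pos) auto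
  also have "\<dots> \<le> 16 / (y * exp (pi * y))"
    using y pi_less_4 by (simp add: field_simps)
  also have "\<dots> = (4 * (y powr (- 1 / 2) * exp (- pi * y / 2)))\<^sup>2"
  proof -
    have "(y powr (- 1 / 2))\<^sup>2 = 1 / y"
      using y by (simp add: power2_eq_square powr_add[symmetric] powr_minus_divide)
    moreover have "(exp (- pi * y / 2))\<^sup>2 = 1 / exp (pi * y)"
      by (simp add: exp_double[symmetric] exp_minus field_simps)
    ultimately show ?thesis by (simp add: power_mult_distrib)
  qed
  finally show "(cmod (Gamma (Complex 0 y)))\<^sup>2 \<le> (4 * (y powr (- 1 / 2) * exp (- pi * y / 2)))\<^sup>2"
    using cmod_Gamma_imaginary[of y] y by simp
qed auto

text \<open>
  The reflection formula bounds \<open>1/\<bar>\<Gamma>(z)\<bar>\<close> by \<open>\<bar>\<Gamma>(1 - z)\<bar> \<bar>sin \<pi>z\<bar>\<close>, so the second estimate is the first one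
  at \<open>1 - x\<close> combined with \<open>\<bar>sin \<pi>z\<bar> \<le> e\<^sup>\<pi>\<^sup>y\<close>.
\<close>

lemma Gamma_vertical_bounds:
  obtains C :: real where "C > 0"
    "\<And>x y. 0 < x \<Longrightarrow> x < 1 \<Longrightarrow> y \<ge> 1 \<Longrightarrow>
      cmod (Gamma (Complex x y)) \<le> C * (y powr (x - 1 / 2) * exp (- pi * y / 2))"
    "\<And>x y. 0 < x \<Longrightarrow> x < 1 \<Longrightarrow> y \<ge> 1 \<Longrightarrow>
      inverse (cmod (Gamma (Complex x y))) \<le> C * (y powr (1 / 2 - x) * exp (pi * y / 2))"
proof -
  obtain A where A: "A > 0"
    and le: "\<And>x y. 0 \<le> x \<Longrightarrow> x \<le> 1 \<Longrightarrow> y \<ge> 1 \<Longrightarrow>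
      cmod (Gamma (Complex x y)) \<le> A * (cmod (Gamma (Complex 0 y)) * y powr x)"
    using Gamma_interpolation by blast
  have up: "cmod (Gamma (Complex x y)) \<le> 4 * A * (y powr (x - 1 / 2) * exp (- pi * y / 2))"
    if x: "0 < x" "x < 1" and y: "y \<ge> 1" for x y
  proof -
    have "cmod (Gamma (Complex x y)) \<le> A * (cmod (Gamma (Complex 0 y)) * y powr x)"
      using le x y by simp
    also have "\<dots> \<le> A * ((4 * (y powr (- 1 / 2) * exp (- pi * y / 2))) * y powr x)"
      using A Gamma_imaginary_le[OF y] by (intro mult_left_mono mult_right_mono) auto
    also have "\<dots> = 4 * A * (y powr (x - 1 / 2) * exp (- pi * y / 2))"
      using y by (simp add: powr_add[symmetric])
    finally show ?thesis .
  qed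
  have low: "inverse (cmod (Gamma (Complex x y))) \<le> 4 * A * (y powr (1 / 2 - x) * exp (pi * y / 2))"
    if x: "0 < x" "x < 1" and y: "y \<ge> 1" for x y
  proof -
    define z where "z = Complex x y"
    have "cnj (1 - z) = Complex (1 - x) y" by (simp add: z_def complex_eq_iff)
    then have "cmod (Gamma (1 - z)) = cmod (Gamma (Complex (1 - x) y))"
      by (metis complex_mod_cnj cnj_Gamma)
    also have "\<dots> \<le> 4 * A * (y powr (1 / 2 - x) * exp (- pi * y / 2))"
      using up[of "1 - x" y] x y by simp
    finally have refl: "cmod (Gamma (1 - z)) \<le> 4 * A * (y powr (1 / 2 - x) * exp (- pi * y / 2))" .
    have "(cmod (sin (of_real pi * z)))\<^sup>2 \<le> (exp (pi * y))\<^sup>2"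
    proof -
      define E where "E = exp (2 * (pi * y))"
      define c where "c = cos (2 * Re (of_real pi * z))"
      have "1 \<le> E" using y by (simp add: E_def)
      moreover have "inverse E \<le> 1" using \<open>1 \<le> E\<close> by (simp add: inverse_le_1_iff)
      moreover have "- 1 \<le> c" unfolding c_def by (rule cos_ge_minus_one)
      ultimately have "(E + inverse E - 2 * c) / 4 \<le> E" by simp
      moreover have "exp (2 * Im (of_real pi * z)) = E" by (simp add: E_def z_def)
      ultimately have "(cmod (sin (of_real pi * z)))\<^sup>2 \<le> E"
        unfolding norm_sin_squared c_def by simp
      then show ?thesis by (simp add: E_def exp_double)
    qed
    then have sn: "cmod (sin (of_real pi * z)) \<le> exp (pi * y)"
      by (rule power2_le_imp_le) auto
    have nz: "Gamma z \<noteq> 0" "Gamma (1 - z) \<noteq> 0"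
      using y unfolding Gamma_eq_zero_iff z_def
      by (auto simp: complex_eq_iff elim!: nonpos_Ints_cases)
    have "Gamma z * Gamma (1 - z) * sin (of_real pi * z) = of_real pi"
    proof -
      have "sin (of_real pi * z) \<noteq> 0"
        using nz Gamma_reflection_complex[of z] by auto
      then show ?thesis by (simp add: Gamma_reflection_complex)
    qed
    then have "cmod (Gamma z) * cmod (Gamma (1 - z)) * cmod (sin (of_real pi * z)) = pi"
      by (metis norm_mult norm_of_real abs_of_pos pi_gt_zero)
    then have "inverse (cmod (Gamma z)) = cmod (Gamma (1 - z)) * cmod (sin (of_real pi * z)) / pi"
      using nz by (simp add: field_simps)
    also have "\<dots> \<le> cmod (Gamma (1 - z)) * cmod (sin (of_real pi * z))"
      using pi_gt3 by (simp add: divide_le_eq mult_le_cancel_left1 not_less)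
    also have "\<dots> \<le> (4 * A * (y powr (1 / 2 - x) * exp (- pi * y / 2))) * exp (pi * y)"
      using refl sn A by (intro mult_mono) auto
    also have "\<dots> = 4 * A * (y powr (1 / 2 - x) * exp (pi * y / 2))"
      by (simp add: exp_add[symmetric])
    finally show ?thesis by (simp add: z_def)
  qed
  show thesis by (rule that[of "4 * A"]) (use A up low in auto)
qed

section \<open>Repeated averaging of the alternating series\<close>

text \<open>
  The \<open>k\<close>-th forward difference of \<open>x\<^sup>-\<^sup>s\<close> times \<open>(- 1)\<^sup>k\<close>. With this sign, taking means of consecutive terms
  in the alternating sum of \<open>altdiff k\<close> leads to half the alternating sum of \<open>altdiff (Suc k)\<close>.
\<close>

fun altdiff :: "nat \<Rightarrow> complex \<Rightarrow> real \<Rightarrow> complex" where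
  "altdiff 0 s x = of_real x powr (- s)"
| "altdiff (Suc k) s x = altdiff k s x - altdiff k s (x + 1)"

lemma altdiff_has_vector_derivative:
  assumes "x > 0"
  shows "((\<lambda>x. altdiff k s x) has_vector_derivative (- s * altdiff k (s + 1) x)) (at x within A)"
  using assms
proof (induction k arbitrary: x A)
  case 0
  have "((\<lambda>x. of_real x powr (- s)) has_vector_derivative (- s * of_real x powr (- s - 1))) (at x within A)"
    using 0 by (auto intro!: has_vector_derivative_real_field derivative_eq_intros
        simp: complex_nonpos_Reals_iff)
  then show ?case by simp
next
  case (Suc k)
  have "((\<lambda>x. altdiff k s (x + 1)) has_vector_derivative (1 *\<^sub>R (- s * altdiff k (s + 1) (x + 1)))) (at x within A)"
    by (rule vector_diff_chain_within[of "\<lambda>x. x + 1", unfolded o_def])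
      (use Suc in \<open>auto intro!: derivative_eq_intros\<close>)
  then show ?case
    using Suc by (auto intro!: derivative_eq_intros simp: algebra_simps)
qed

text \<open>
  Each difference costs one derivative, and differentiating \<open>x\<^sup>-\<^sup>s\<close> replaces \<open>s\<close> by \<open>s + 1\<close> and gives a
  factor \<open>- s\<close>. Hence the induction runs over all \<open>s\<close> at once, through the mean value inequality on
  \<open>[x, x + 1]\<close>.
\<close>

lemma cmod_altdiff_le:
  assumes "x > 0" "Re s + real k \<ge> 0"
  shows "cmod (altdiff k s x) \<le> (\<Prod>j<k. cmod (s + of_nat j)) * x powr (- Re s - real k)"
  using assms
proof (induction k arbitrary: s x)
  case 0
  then show ?case by (simp add: norm_powr_real_powr)
next
  case (Suc k)
  define P where "P = (\<Prod>j<k. cmod (s + 1 + of_nat j))"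
  define B where "B = cmod s * P * x powr (- Re s - real (Suc k))"
  have P: "P \<ge> 0" by (auto simp: P_def intro: prod_nonneg)
  have "norm (altdiff k s (x + 1) - altdiff k s x) \<le> B * norm (x + 1 - x)"
  proof (rule differentiable_bound[of "{x..x + 1}"])
    fix y assume y: "y \<in> {x..x + 1}"
    then have y0: "y > 0" "x \<le> y" using Suc.prems by auto
    show "((\<lambda>x. altdiff k s x) has_derivative (\<lambda>h. h *\<^sub>R (- s * altdiff k (s + 1) y)))
        (at y within {x..x + 1})"
      using altdiff_has_vector_derivative[OF y0(1)] by (simp add: has_vector_derivative_def)
    have "cmod (altdiff k (s + 1) y) \<le> P * y powr (- Re (s + 1) - real k)"
      unfolding P_def by (rule Suc.IH) (use Suc.prems y0 in auto)
    also have "\<dots> \<le> P * x powr (- Re s - real (Suc k))"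
    proof (rule mult_left_mono[OF _ P])
      have "y powr (- Re s - real (Suc k)) \<le> x powr (- Re s - real (Suc k))"
        using Suc.prems y0 by (intro powr_mono2') auto
      moreover have "- Re (s + 1) - real k = - Re s - real (Suc k)" by simp
      ultimately show "y powr (- Re (s + 1) - real k) \<le> x powr (- Re s - real (Suc k))"
        by metis
    qed
    finally have "cmod s * cmod (altdiff k (s + 1) y) \<le> B"
      unfolding B_def mult.assoc by (intro mult_left_mono) auto
    moreover have "onorm (\<lambda>h::real. h *\<^sub>R (- s * altdiff k (s + 1) y)) \<le> cmod (- s * altdiff k (s + 1) y)"
      by (rule onorm_le) (simp add: norm_mult)
    ultimately show "onorm (\<lambda>h::real. h *\<^sub>R (- s * altdiff k (s + 1) y)) \<le> B"
      by (simp add: norm_mult)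
  qed auto
  then have "cmod (altdiff (Suc k) s x) \<le> B"
    by (simp add: norm_minus_commute)
  also have "cmod s * P = (\<Prod>j<Suc k. cmod (s + of_nat j))"
    unfolding P_def by (subst prod.lessThan_Suc_shift) (simp add: algebra_simps)
  then have "B = (\<Prod>j<Suc k. cmod (s + of_nat j)) * x powr (- Re s - real (Suc k))"
    by (simp add: B_def)
  finally show ?case .
qed

lemma prod_cmod_le:
  assumes "cmod s + real k \<le> R"
  shows "(\<Prod>j<k. cmod (s + of_nat j)) \<le> R ^ k"
proof -
  have "(\<Prod>j<k. cmod (s + of_nat j)) \<le> (\<Prod>j<k. R)"
  proof (rule prod_mono)
    fix j assume "j \<in> {..<k}"
    then show "0 \<le> cmod (s + of_nat j) \<and> cmod (s + of_nat j) \<le> R"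
      using norm_triangle_ineq[of s "of_nat j"] assms by simp
  qed
  then show ?thesis by simp
qed

definition alt_tail :: "nat \<Rightarrow> complex \<Rightarrow> nat \<Rightarrow> complex" where
  "alt_tail k s N = (\<Sum>n. (- 1) ^ n * altdiff k s (real (N + n)))"

lemma summable_altdiff:
  assumes N: "N > 0" and s: "Re s + real k > 1"
  shows "summable (\<lambda>n. (- 1) ^ n * altdiff k s (real (N + n)))"
proof (rule summable_comparison_test')
  define P where "P = (\<Prod>j<k. cmod (s + of_nat j))"
  show "summable (\<lambda>n. P * real n powr (- Re s - real k))"
    using s by (intro summable_mult) (simp add: summable_real_powr_iff)
  show "norm ((- 1) ^ n * altdiff k s (real (N + n))) \<le> P * real n powr (- Re s - real k)"
    if n: "n \<ge> 1" for n
  proof -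
    have "norm ((- 1) ^ n * altdiff k s (real (N + n))) = cmod (altdiff k s (real (N + n)))"
      by (simp add: norm_mult norm_power)
    also have "\<dots> \<le> P * real (N + n) powr (- Re s - real k)"
      unfolding P_def by (rule cmod_altdiff_le) (use N s in auto)
    also have "\<dots> \<le> P * real n powr (- Re s - real k)"
      using n s by (intro mult_left_mono powr_mono2') (auto simp: P_def intro: prod_nonneg)
    finally show ?thesis .
  qed
qed

lemma alt_tail_shift:
  assumes N: "N > 0" and s: "Re s + real k > 1"
  shows "alt_tail k s N + alt_tail k s (Suc N) = altdiff k s (real N)"
proof -
  have "alt_tail k s N = altdiff k s (real N) + (\<Sum>n. - ((- 1) ^ n * altdiff k s (real (Suc N + n))))"
    unfolding alt_tail_def using suminf_split_head[OF summable_altdiff[OF N s]] by simp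
  also have "(\<Sum>n. - ((- 1) ^ n * altdiff k s (real (Suc N + n)))) = - alt_tail k s (Suc N)"
    unfolding alt_tail_def by (rule suminf_minus) (rule summable_altdiff, use s in auto)
  finally show ?thesis by simp
qed

text \<open>
  The new series is the difference of the old one and its shift by one, and these two add up to the
  first term.
\<close>

lemma alt_tail_Suc:
  assumes N: "N > 0" and s: "Re s + real k > 1"
  shows "alt_tail (Suc k) s N = 2 * alt_tail k s N - altdiff k s (real N)"
proof -
  have "alt_tail (Suc k) s N = (\<Sum>n. (- 1) ^ n * altdiff k s (real (N + n))
      - (- 1) ^ n * altdiff k s (real (Suc N + n)))"
    unfolding alt_tail_def by (simp add: algebra_simps)
  also have "\<dots> = alt_tail k s N - alt_tail k s (Suc N)"
    unfolding alt_tail_def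
    using suminf_diff[OF summable_altdiff[OF N s] summable_altdiff[of "Suc N" s k]] s by simp
  also have "alt_tail k s (Suc N) = altdiff k s (real N) - alt_tail k s N"
    using alt_tail_shift[OF assms] by (metis add_diff_cancel_left')
  finally show ?thesis by simp
qed

text \<open>
  Euler's transformation of \<open>\<Sum>n. (- 1)\<^sup>n (N + n)\<^sup>-\<^sup>s\<close> after \<open>k\<close> steps. The remaining series converges absolutely
  for \<open>Re s > 1 - k\<close>, and on the common half-plane two consecutive steps agree, so together they define
  the analytic continuation.
\<close>

definition euler_transform :: "nat \<Rightarrow> complex \<Rightarrow> nat \<Rightarrow> complex" where
  "euler_transform k s N = (\<Sum>j<k. altdiff j s (real N) / 2 ^ Suc j) + alt_tail k s N / 2 ^ k"

lemma euler_transform_Suc: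
  assumes "N > 0" "Re s + real k > 1"
  shows "euler_transform (Suc k) s N = euler_transform k s N"
  unfolding euler_transform_def alt_tail_Suc[OF assms] by (simp add: field_simps)

lemma euler_transform_indep:
  assumes "N > 0" "Re s + real k > 1" "k \<le> m"
  shows "euler_transform m s N = euler_transform k s N"
  using assms(3)
proof (induction m rule: dec_induct)
  case (step m)
  then show ?case using euler_transform_Suc[of N s m] assms by simp
qed simp

text \<open>
  The functional equation that the continued tail inherits from \<open>\<Sum>n. (- 1)\<^sup>n (N + n)\<^sup>-\<^sup>s\<close>. It can be seen
  at every stage \<open>k\<close> because the finite parts for \<open>N\<close> and \<open>N + 1\<close> telescope.
\<close>

lemma euler_transform_shift:
  assumes N: "N > 0" and s: "Re s + real k > 1"
  shows "euler_transform k s N + euler_transform k s (Suc N) = of_nat N powr (- s)"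
proof -
  have tele: "(\<Sum>j<m. altdiff j s (real N) / 2 ^ Suc j) + (\<Sum>j<m. altdiff j s (real (Suc N)) / 2 ^ Suc j)
      = of_nat N powr (- s) - altdiff m s (real N) / 2 ^ m" for m
  proof (induction m)
    case (Suc m)
    have "altdiff m s (real (Suc N)) = altdiff m s (real N) - altdiff (Suc m) s (real N)"
      by (simp add: add.commute)
    then have step: "altdiff m s (real N) / 2 ^ Suc m + altdiff m s (real (Suc N)) / 2 ^ Suc m
        = altdiff m s (real N) / 2 ^ m - altdiff (Suc m) s (real N) / 2 ^ Suc m"
      by (simp add: field_simps)
    have "(\<Sum>j<Suc m. altdiff j s (real N) / 2 ^ Suc j) + (\<Sum>j<Suc m. altdiff j s (real (Suc N)) / 2 ^ Suc j)
        = ((\<Sum>j<m. altdiff j s (real N) / 2 ^ Suc j) + (\<Sum>j<m. altdiff j s (real (Suc N)) / 2 ^ Suc j))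
          + (altdiff m s (real N) / 2 ^ Suc m + altdiff m s (real (Suc N)) / 2 ^ Suc m)"
      by (simp only: sum.lessThan_Suc ac_simps)
    also have "\<dots> = of_nat N powr (- s) - altdiff (Suc m) s (real N) / 2 ^ Suc m"
      unfolding Suc step by simp
    finally show ?case .
  qed simp
  have "alt_tail k s N / 2 ^ k + alt_tail k s (Suc N) / 2 ^ k = altdiff k s (real N) / 2 ^ k"
    using alt_tail_shift[OF assms] by (simp add: add_divide_distrib[symmetric])
  moreover have "euler_transform k s N + euler_transform k s (Suc N)
      = ((\<Sum>j<k. altdiff j s (real N) / 2 ^ Suc j) + (\<Sum>j<k. altdiff j s (real (Suc N)) / 2 ^ Suc j))
        + (alt_tail k s N / 2 ^ k + alt_tail k s (Suc N) / 2 ^ k)"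
    unfolding euler_transform_def by (simp only: ac_simps)
  ultimately show ?thesis
    unfolding tele by simp
qed

lemma altdiff_holomorphic:
  "x > 0 \<Longrightarrow> (\<lambda>s. altdiff k s x) holomorphic_on A"
  by (induction k arbitrary: x) (auto intro!: holomorphic_intros)

text \<open>
  The Weierstrass test in the form that is convenient for Dirichlet series, with a majorant that may
  depend on the neighbourhood.
\<close>

lemma holomorphic_on_suminf:
  fixes f :: "nat \<Rightarrow> complex \<Rightarrow> complex"
  assumes S: "open S" and hol: "\<And>n. f n holomorphic_on S"
    and bound: "\<And>z. z \<in> S \<Longrightarrow> \<exists>d h. 0 < d \<and> summable h \<and> (\<forall>n. \<forall>w\<in>ball z d \<inter> S. norm (f n w) \<le> h n)"
  shows "(\<lambda>z. \<Sum>n. f n z) holomorphic_on S"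
proof -
  have "\<exists>g g'. \<forall>x\<in>S. ((\<lambda>n. f n x) sums g x) \<and> ((\<lambda>n. deriv (f n) x) sums g' x)
      \<and> (g has_field_derivative g' x) (at x)"
  proof (rule series_and_derivative_comparison_local[OF S])
    show "(f n has_field_derivative deriv (f n) x) (at x)" if "x \<in> S" for n x
      using holomorphic_derivI[OF hol S that] .
    show "\<exists>d h. 0 < d \<and> summable h \<and> (\<forall>\<^sub>F n in sequentially. \<forall>y\<in>ball x d \<inter> S. norm (f n y) \<le> h n)"
      if x: "x \<in> S" for x
    proof -
      obtain d h where "0 < d" "summable h" "\<And>n. \<forall>w\<in>ball x d \<inter> S. norm (f n w) \<le> h n"
        using bound[OF x] by auto
      then show ?thesis by (intro exI[of _ d] exI[of _ h]) simp
    qed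
  qed
  then obtain g g' where g: "\<And>x. x \<in> S \<Longrightarrow> (\<lambda>n. f n x) sums g x"
    "\<And>x. x \<in> S \<Longrightarrow> (g has_field_derivative g' x) (at x)" by blast
  then have "g holomorphic_on S"
    by (auto simp: holomorphic_on_open[OF S])
  then show ?thesis
    by (rule holomorphic_transform) (use g(1) in \<open>simp add: sums_iff\<close>)
qed

lemma euler_transform_holomorphic:
  assumes N: "N > 0"
  shows "(\<lambda>s. euler_transform k s N) holomorphic_on {s. Re s + real k > 1}"
proof -
  define S where "S = {s. Re s + real k > 1}"
  have S: "open S" 
  proof -
    have "S = {s. Re s > 1 - real k}" by (auto simp: S_def)
    then show ?thesis by (simp add: open_halfspace_Re_gt)
  qed
  have "(\<lambda>s. \<Sum>n. (- 1) ^ n * altdiff k s (real (N + n))) holomorphic_on S"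
  proof (rule holomorphic_on_suminf[OF S])
    show "(\<lambda>s. (- 1) ^ n * altdiff k s (real (N + n))) holomorphic_on S" for n
      using N by (intro holomorphic_intros altdiff_holomorphic) auto
    fix z assume z: "z \<in> S"
    define d where "d = (Re z + real k - 1) / 2"
    define R where "R = cmod z + d + real k"
    define h where "h = (\<lambda>n. R ^ k * real (N + n) powr (- 1 - d))"
    have d2: "2 * d = Re z + real k - 1" by (simp add: d_def)
    have d: "d > 0" using z by (simp add: d_def S_def)
    have "summable (\<lambda>n. real (n + N) powr (- 1 - d))"
      using d by (subst summable_iff_shift) (simp add: summable_real_powr_iff)
    then have "summable h" unfolding h_def by (intro summable_mult) (simp add: add.commute)
    moreover have "norm ((- 1) ^ n * altdiff k w (real (N + n))) \<le> h n" if w: "w \<in> ball z d" for n w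
    proof -
      have wz: "cmod (w - z) < d" using w by (simp add: dist_norm norm_minus_commute)
      then have "\<bar>Re w - Re z\<bar> < d" using abs_Re_le_cmod[of "w - z"] by simp
      then have Re: "Re w + real k \<ge> 1 + d" using d2 by linarith
      have "cmod w \<le> cmod z + d" using wz norm_triangle_ineq2[of w z] by linarith
      then have P: "(\<Prod>j<k. cmod (w + of_nat j)) \<le> R ^ k"
        by (intro prod_cmod_le) (simp add: R_def)
      have "norm ((- 1) ^ n * altdiff k w (real (N + n))) = cmod (altdiff k w (real (N + n)))"
        by (simp add: norm_mult norm_power)
      also have "\<dots> \<le> (\<Prod>j<k. cmod (w + of_nat j)) * real (N + n) powr (- Re w - real k)"
        by (rule cmod_altdiff_le) (use N Re d in auto)
      also have "\<dots> \<le> R ^ k * real (N + n) powr (- 1 - d)"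
        using N Re P d by (intro mult_mono powr_mono) (auto simp: R_def intro!: zero_le_power)
      finally show ?thesis by (simp add: h_def)
    qed
    ultimately show "\<exists>d h. 0 < d \<and> summable h \<and>
        (\<forall>n. \<forall>w\<in>ball z d \<inter> S. norm ((- 1) ^ n * altdiff k w (real (N + n))) \<le> h n)"
      using d by blast
  qed
  then show ?thesis
    unfolding euler_transform_def alt_tail_def S_def[symmetric] using N
    by (intro holomorphic_intros altdiff_holomorphic) auto
qed

text \<open>
  The analytic continuation of \<open>\<Sum>n. (- 1)\<^sup>n (N + n)\<^sup>-\<^sup>s\<close> to the whole plane. The number of averaging steps
  makes the remaining series absolutely convergent at \<open>s\<close>. For \<open>N = 1\<close> this is the Dirichlet eta function.
\<close>

definition eta_tail :: "nat \<Rightarrow> complex \<Rightarrow> complex" where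
  "eta_tail N s = euler_transform (nat \<lceil>2 - Re s\<rceil>) s N"

lemma eta_tail_eq:
  assumes "N > 0" "Re s + real k > 1"
  shows "eta_tail N s = euler_transform k s N"
proof -
  define m where "m = nat \<lceil>2 - Re s\<rceil>"
  have m: "Re s + real m > 1" unfolding m_def by linarith
  show ?thesis
  proof (cases "k \<le> m")
    case True
    then show ?thesis
      using euler_transform_indep[OF assms True] by (simp add: eta_tail_def m_def)
  next
    case False
    then show ?thesis
      using euler_transform_indep[OF assms(1) m, of k] False
      unfolding eta_tail_def m_def[symmetric] by (metis nat_le_linear)
  qed
qed

lemma eta_tail_holomorphic:
  assumes N: "N > 0"
  shows "eta_tail N holomorphic_on UNIV"
proof -
  have "eta_tail N holomorphic_on (\<Union>k. {s. Re s + real k > 1})"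
  proof (rule holomorphic_on_UN_open)
    fix k :: nat
    have "{s. Re s + real k > 1} = {s. Re s > 1 - real k}" by auto
    then show "open {s. Re s + real k > 1}" by (simp add: open_halfspace_Re_gt)
    show "eta_tail N holomorphic_on {s. Re s + real k > 1}"
      by (rule holomorphic_transform[OF euler_transform_holomorphic[OF N]])
        (use eta_tail_eq[OF N] in auto)
  qed
  moreover have "(\<Union>k. {s. Re s + real k > 1}) = UNIV"
  proof -
    have "\<exists>k::nat. Re s + real k > 1" for s
      using reals_Archimedean2[of "1 - Re s"] by (auto simp: algebra_simps)
    then show ?thesis by auto
  qed
  ultimately show ?thesis by simp
qed

lemma eta_tail_shift:
  assumes "N > 0"
  shows "eta_tail N s + eta_tail (Suc N) s = of_nat N powr (- s)"
proof -
  obtain k :: nat where k: "Re s + real k > 1"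
    using reals_Archimedean2[of "1 - Re s"] by (auto simp: algebra_simps)
  show ?thesis
    using euler_transform_shift[OF assms k] eta_tail_eq[OF _ k] assms by simp
qed

lemma eta_eq_partial_sum_plus_tail:
  "eta_tail 1 s = (\<Sum>n=1..<Suc N. (- 1) ^ Suc n * of_nat n powr (- s)) + (- 1) ^ N * eta_tail (Suc N) s"
proof (induction N)
  case (Suc N)
  let ?S = "\<Sum>n=1..<Suc N. (- 1) ^ Suc n * of_nat n powr (- s)"
  have "eta_tail (Suc N) s = of_nat (Suc N) powr (- s) - eta_tail (Suc (Suc N)) s"
    using eta_tail_shift[of "Suc N" s] by (simp add: algebra_simps)
  then have "eta_tail 1 s = ?S + (- 1) ^ N * (of_nat (Suc N) powr (- s) - eta_tail (Suc (Suc N)) s)"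
    using Suc.IH by metis
  also have "\<dots> = (?S + (- 1) ^ Suc (Suc N) * of_nat (Suc N) powr (- s))
      + (- 1) ^ Suc N * eta_tail (Suc (Suc N)) s"
    by (simp add: right_diff_distrib)
  also have "?S + (- 1) ^ Suc (Suc N) * of_nat (Suc N) powr (- s)
      = (\<Sum>n=1..<Suc (Suc N). (- 1) ^ Suc n * of_nat n powr (- s))"
    by (subst sum.atLeastLessThan_Suc[of 1 "Suc N"]) simp_all
  finally show ?case .
qed simp

text \<open>
  If \<open>\<bar>s\<bar> + K \<le> N\<close>, every difference up to order \<open>K\<close> is at most \<open>N\<^sup>-\<^sup>\<sigma>\<close>, so the finite part of the
  Euler transform is bounded by \<open>N\<^sup>-\<^sup>\<sigma>\<close> times a geometric series. Estimating the remaining series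
  trivially loses a factor \<open>N\<close> against this. The factor \<open>2\<^sup>-\<^sup>K\<close> in front of it makes up for the loss
  when \<open>N = 2\<^sup>K\<close>.
\<close>

lemma cmod_eta_tail_le:
  assumes K: "K \<ge> 2" and N: "N = 2 ^ K" and s: "Re s > 0" "cmod s + real K \<le> real N"
  shows "cmod (eta_tail N s) \<le> 3 * real N powr (- Re s)"
proof -
  define x where "x = real N"
  have x: "x > 0" "x = 2 ^ K" by (auto simp: x_def N)
  have x2: "x \<ge> 2" using power_increasing[of 1 K "2::real"] K x by simp
  have P: "(\<Prod>j<k. cmod (s + of_nat j)) \<le> x ^ k" if "k \<le> K" for k
    by (rule prod_cmod_le) (use that s in \<open>simp add: x_def\<close>)
  have summand: "cmod (altdiff j s x) \<le> x powr (- Re s)" if "j \<le> K" for j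
  proof -
    have "cmod (altdiff j s x) \<le> (\<Prod>j<j. cmod (s + of_nat j)) * x powr (- Re s - real j)"
      by (rule cmod_altdiff_le) (use x s in auto)
    also have "\<dots> \<le> x ^ j * x powr (- Re s - real j)"
      using P[OF that] by (intro mult_right_mono) auto
    also have "\<dots> = x powr (- Re s)"
    proof -
      have "x ^ j * x powr (- Re s - real j) = x powr real j * x powr (- Re s - real j)"
        using x(1) by (simp only: powr_realpow)
      then show ?thesis by (simp add: powr_add[symmetric])
    qed
    finally show ?thesis .
  qed
  have "cmod (\<Sum>j<K. altdiff j s x / 2 ^ Suc j) \<le> (\<Sum>j<K. x powr (- Re s) * (1 / 2) ^ Suc j)"
  proof (rule sum_norm_le)
    fix j assume "j \<in> {..<K}"
    then have "cmod (altdiff j s x) / 2 ^ Suc j \<le> x powr (- Re s) / 2 ^ Suc j"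
      using summand[of j] by (intro divide_right_mono) auto
    then show "cmod (altdiff j s x / 2 ^ Suc j) \<le> x powr (- Re s) * (1 / 2) ^ Suc j"
      by (simp add: norm_divide norm_mult norm_power power_divide)
  qed
  also have "\<dots> = x powr (- Re s) * (\<Sum>j<K. (1 / 2) ^ Suc j)"
    by (simp only: sum_distrib_left)
  also have "(\<Sum>j<K. (1 / 2 :: real) ^ Suc j) = 1 - (1 / 2) ^ K"
    by (induction K) (auto simp: field_simps)
  finally have part1: "cmod (\<Sum>j<K. altdiff j s x / 2 ^ Suc j) \<le> x powr (- Re s)"
    using x by (smt (verit) mult_left_le powr_ge_zero zero_le_power divide_nonneg_nonneg)
  \<comment> \<open>A telescoping majorant of the tail of the sum of inverse squares.\<close>
  have sq: "(\<lambda>n. 1 / ((x - 1 + real n) * (x + real n))) sums (1 / (x - 1))"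
  proof -
    have "(\<lambda>n. 1 / (x - 1 + real n)) \<longlonglongrightarrow> 0" by real_asymp
    then have "(\<lambda>n. 1 / (x - 1 + real n) - 1 / (x - 1 + real (Suc n))) sums (1 / (x - 1 + real 0) - 0)"
      by (rule telescope_sums')
    moreover have "1 / (x - 1 + real n) - 1 / (x - 1 + real (Suc n)) = 1 / ((x - 1 + real n) * (x + real n))" for n
    proof -
      have "x - 1 + real n \<noteq> 0" "x + real n \<noteq> 0" using x2 by auto
      then show ?thesis by (simp add: field_simps)
    qed
    ultimately show ?thesis by simp
  qed
  have "cmod (alt_tail K s N) \<le> (\<Sum>n. x ^ K * x powr (2 - Re s - real K) * (1 / ((x - 1 + real n) * (x + real n))))"
    unfolding alt_tail_def
  proof (rule norm_suminf_le)
    show "summable (\<lambda>n. x ^ K * x powr (2 - Re s - real K) * (1 / ((x - 1 + real n) * (x + real n))))"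
      using sq by (intro summable_mult) (simp add: sums_iff)
    fix n
    have "norm ((- 1) ^ n * altdiff K s (real (N + n))) = cmod (altdiff K s (x + real n))"
      by (simp add: norm_mult norm_power x_def)
    also have "\<dots> \<le> (\<Prod>j<K. cmod (s + of_nat j)) * (x + real n) powr (- Re s - real K)"
      by (rule cmod_altdiff_le) (use x(1) s in auto)
    also have "\<dots> \<le> x ^ K * (x powr (2 - Re s - real K) * (1 / ((x - 1 + real n) * (x + real n))))"
    proof (intro mult_mono P)
      have "(x + real n) powr (- Re s - real K) = (x + real n) powr (2 - Re s - real K) * (x + real n) powr (- 2)"
        by (simp add: powr_add[symmetric])
      also have "\<dots> \<le> x powr (2 - Re s - real K) * (1 / ((x - 1 + real n) * (x + real n)))"
      proof (rule mult_mono)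
        show "(x + real n) powr (2 - Re s - real K) \<le> x powr (2 - Re s - real K)"
          using x s K by (intro powr_mono2') auto
        have "(x + real n) powr (- 2) = 1 / ((x + real n) * (x + real n))"
          using x by (simp add: powr_minus_divide power2_eq_square)
        also have "\<dots> \<le> 1 / ((x - 1 + real n) * (x + real n))"
          using x2 by (intro divide_left_mono mult_right_mono) auto
        finally show "(x + real n) powr (- 2) \<le> 1 / ((x - 1 + real n) * (x + real n))" .
      qed auto
      finally show "(x + real n) powr (- Re s - real K)
          \<le> x powr (2 - Re s - real K) * (1 / ((x - 1 + real n) * (x + real n)))" .
    qed (use x in auto)
    finally show "norm ((- 1) ^ n * altdiff K s (real (N + n)))
        \<le> x ^ K * x powr (2 - Re s - real K) * (1 / ((x - 1 + real n) * (x + real n)))"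
      by (simp only: mult.assoc)
  qed
  also have "\<dots> = x ^ K * x powr (2 - Re s - real K) * (1 / (x - 1))"
    using sq by (subst suminf_mult) (simp_all add: sums_iff)
  also have "\<dots> \<le> x ^ K * x powr (2 - Re s - real K) * (2 / x)"
    using x2 by (intro mult_left_mono) (auto simp: field_simps)
  also have "\<dots> = 2 * x powr (- Re s) * x"
  proof -
    have "x ^ K * x powr (2 - Re s - real K) = x powr (- Re s) * x ^ 2"
    proof -
      have "x ^ K * x powr (2 - Re s - real K) = x powr real K * x powr (2 - Re s - real K)"
        using x(1) by (simp only: powr_realpow)
      also have "\<dots> = x powr (- Re s) * x powr real 2"
        by (simp add: powr_add[symmetric])
      also have "x powr real 2 = x ^ 2"
        by (rule powr_realpow[OF x(1)])
      finally show ?thesis .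
    qed
    then show ?thesis using x(1) by (simp add: power2_eq_square)
  qed
  finally have "cmod (alt_tail K s N) / 2 ^ K \<le> 2 * x powr (- Re s)"
    using x by (simp add: field_simps)
  then have part2: "cmod (alt_tail K s N / 2 ^ K) \<le> 2 * x powr (- Re s)"
    by (simp add: norm_divide norm_power)
  have "eta_tail N s = (\<Sum>j<K. altdiff j s x / 2 ^ Suc j) + alt_tail K s N / 2 ^ K"
    using eta_tail_eq[of N s K] s K by (simp add: N euler_transform_def x_def)
  then show ?thesis
    using norm_triangle_ineq[of "\<Sum>j<K. altdiff j s x / 2 ^ Suc j" "alt_tail K s N / 2 ^ K"]
      part1 part2 by (simp add: x_def)
qed

section \<open>The analytic continuation of zeta\<close>

abbreviation dirichlet_zeta :: "complex \<Rightarrow> complex" where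
  "dirichlet_zeta s \<equiv> (\<Sum>n. 1 / of_nat (Suc n) powr s)"

lemma dirichlet_zeta_sums:
  assumes "Re s > 1"
  shows "(\<lambda>n. of_nat (Suc n) powr (- s)) sums dirichlet_zeta s"
    and "summable (\<lambda>n. of_nat (Suc n) powr (- s) :: complex)"
proof -
  show sm: "summable (\<lambda>n. of_nat (Suc n) powr (- s) :: complex)"
  proof (rule summable_norm_cancel)
    have "summable (\<lambda>n. real (Suc n) powr (- Re s))"
      using assms by (subst summable_Suc_iff) (simp add: summable_real_powr_iff)
    moreover have "norm (of_nat (Suc n) powr (- s) :: complex) = real (Suc n) powr (- Re s)" for n
      using norm_powr_real_powr[of "complex_of_real (real (Suc n))" "- s"] by simp
    ultimately show "summable (\<lambda>n. norm (of_nat (Suc n) powr (- s) :: complex))" by simp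
  qed
  then show "(\<lambda>n. of_nat (Suc n) powr (- s)) sums dirichlet_zeta s"
    by (simp only: powr_minus_divide sums_iff)
qed

text \<open>
  Subtracting the alternating series from the full one leaves twice the terms with even \<open>n\<close>, which are
  \<open>2\<^sup>1\<^sup>-\<^sup>s\<close> times the full series.
\<close>

lemma eta_tail_1_eq_dirichlet:
  assumes s: "Re s > 1"
  shows "eta_tail 1 s = (1 - 2 powr (1 - s)) * dirichlet_zeta s"
proof -
  define a where "a = (\<lambda>n. of_nat (Suc n) powr (- s) :: complex)"
  have a: "a sums dirichlet_zeta s" unfolding a_def by (rule dirichlet_zeta_sums[OF s])
  have eta: "(\<lambda>n. (- 1) ^ n * a n) sums eta_tail 1 s"
  proof -
    have "eta_tail 1 s = alt_tail 0 s 1"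
      using eta_tail_eq[of 1 s 0] s by (simp add: euler_transform_def)
    then show ?thesis
      using summable_altdiff[of 1 s 0] s unfolding alt_tail_def a_def
      by (simp add: sums_iff)
  qed
  have "(\<lambda>m. (1 - (- 1) ^ (2 * m + 1)) * a (2 * m + 1)) sums (2 powr (1 - s) * dirichlet_zeta s)"
  proof -
    have "(1 - (- 1) ^ (2 * m + 1)) * a (2 * m + 1) = 2 powr (1 - s) * a m" for m
    proof -
      have "a (2 * m + 1) = (of_real 2 * of_real (real (Suc m))) powr (- s)"
        by (simp add: a_def algebra_simps)
      also have "\<dots> = 2 powr (- s) * a m"
        by (subst powr_times_real) (auto simp: a_def)
      finally show ?thesis by (simp add: powr_diff powr_minus_divide)
    qed
    then show ?thesis using sums_mult[OF a, of "2 powr (1 - s)"] by simp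
  qed
  then have "(\<lambda>n. (1 - (- 1) ^ n) * a n) sums (2 powr (1 - s) * dirichlet_zeta s)"
  proof (subst (asm) sums_mono_reindex[of "\<lambda>m. 2 * m + 1" "\<lambda>n. (1 - (- 1) ^ n) * a n"])
    show "strict_mono (\<lambda>m::nat. 2 * m + 1)" by (simp add: strict_mono_def)
    show "(1 - (- 1) ^ n) * a n = 0" if "n \<notin> range (\<lambda>m. 2 * m + 1)" for n
    proof -
      have "even n" using that by (metis oddE rangeI)
      then show ?thesis by simp
    qed
  qed
  moreover have "(\<lambda>n. (1 - (- 1) ^ n) * a n) sums (dirichlet_zeta s - eta_tail 1 s)"
    using sums_diff[OF a eta] by (simp add: algebra_simps)
  ultimately have "dirichlet_zeta s - eta_tail 1 s = 2 powr (1 - s) * dirichlet_zeta s"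
    using sums_unique2 by blast
  then show ?thesis by (simp add: algebra_simps)
qed

text \<open>
  The difference of \<open>a\<^sup>-\<^sup>s\<close> and the integral of \<open>x\<^sup>-\<^sup>s\<close> over \<open>[a, a + 1]\<close>.
\<close>

definition sum_minus_integral :: "complex \<Rightarrow> real \<Rightarrow> complex" where
  "sum_minus_integral s a = of_real a powr (- s)
     - (of_real (a + 1) powr (1 - s) - of_real a powr (1 - s)) / (1 - s)"

text \<open>
  On \<open>[a, a + 1]\<close> the function \<open>x\<^sup>-\<^sup>s\<close> stays within \<open>\<bar>s\<bar> a\<^sup>-\<^sup>\<sigma>\<^sup>-\<^sup>1\<close> of its value at \<open>a\<close>. The mean value inequality
  is used twice, for this and for comparing the integral with the value.
\<close>

lemma cmod_sum_minus_integral_le: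
  assumes a: "a > 0" and s: "Re s \<ge> 0" "s \<noteq> 1"
  shows "cmod (sum_minus_integral s a) \<le> cmod s * a powr (- Re s - 1)"
proof -
  define B where "B = cmod s * a powr (- Re s - 1)"
  have B: "B \<ge> 0" by (simp add: B_def)
  have inner: "cmod (altdiff 0 s x - altdiff 0 s a) \<le> B" if x: "x \<in> {a..a + 1}" for x
  proof -
    have "norm (altdiff 0 s x - altdiff 0 s a) \<le> B * norm (x - a)"
    proof (rule differentiable_bound[of "{a..a + 1}"])
      fix y assume "y \<in> {a..a + 1}"
      then have y: "y > 0" "a \<le> y" using a by auto
      show "((\<lambda>x. altdiff 0 s x) has_derivative (\<lambda>h. h *\<^sub>R (- s * altdiff 0 (s + 1) y)))
          (at y within {a..a + 1})"
        by (rule altdiff_has_vector_derivative[OF y(1), unfolded has_vector_derivative_def])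
      have "cmod (altdiff 0 (s + 1) y) = y powr (- Re s - 1)"
        using y by (simp add: norm_powr_real_powr)
      also have "\<dots> \<le> a powr (- Re s - 1)"
        using a y s by (intro powr_mono2') auto
      finally have "cmod (- s * altdiff 0 (s + 1) y) \<le> B"
        unfolding B_def norm_mult norm_minus_cancel by (intro mult_left_mono) auto
      moreover have "onorm (\<lambda>h::real. h *\<^sub>R (- s * altdiff 0 (s + 1) y)) \<le> cmod (- s * altdiff 0 (s + 1) y)"
        by (rule onorm_le) (simp add: norm_mult)
      ultimately show "onorm (\<lambda>h::real. h *\<^sub>R (- s * altdiff 0 (s + 1) y)) \<le> B"
        by linarith
    qed (use x a in auto)
    also have "\<dots> \<le> B * 1" using x B by (intro mult_left_mono) auto
    finally show ?thesis by simp
  qed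
  define g where "g = (\<lambda>x. (x - a) *\<^sub>R altdiff 0 s a - altdiff 0 (s - 1) x / (1 - s))"
  have "norm (g (a + 1) - g a) \<le> B * norm (a + 1 - a)"
  proof (rule differentiable_bound[of "{a..a + 1}"])
    fix y assume y: "y \<in> {a..a + 1}"
    then have y0: "y > 0" using a by auto
    have "((\<lambda>x. altdiff 0 (s - 1) x / (1 - s)) has_vector_derivative (- (s - 1) * altdiff 0 (s - 1 + 1) y / (1 - s)))
        (at y within {a..a + 1})"
      by (rule has_vector_derivative_divide[OF altdiff_has_vector_derivative[OF y0]])
    moreover have "- (s - 1) * altdiff 0 (s - 1 + 1) y / (1 - s) = altdiff 0 s y"
      using s by (simp del: altdiff.simps)
    moreover have "((\<lambda>x. (x - a) *\<^sub>R altdiff 0 s a) has_vector_derivative altdiff 0 s a) (at y within {a..a + 1})"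
      by (auto intro!: derivative_eq_intros simp del: altdiff.simps)
    ultimately have "(g has_vector_derivative (altdiff 0 s a - altdiff 0 s y)) (at y within {a..a + 1})"
      unfolding g_def by (metis has_vector_derivative_diff)
    then show "(g has_derivative (\<lambda>h. h *\<^sub>R (altdiff 0 s a - altdiff 0 s y))) (at y within {a..a + 1})"
      by (simp add: has_vector_derivative_def)
    have "onorm (\<lambda>h::real. h *\<^sub>R (altdiff 0 s a - altdiff 0 s y)) \<le> cmod (altdiff 0 s a - altdiff 0 s y)"
      by (rule onorm_le) (simp add: norm_mult)
    then show "onorm (\<lambda>h::real. h *\<^sub>R (altdiff 0 s a - altdiff 0 s y)) \<le> B"
      using inner[OF y] by (simp add: norm_minus_commute)
  qed auto
  moreover have "g (a + 1) - g a = sum_minus_integral s a"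
    by (simp add: g_def sum_minus_integral_def diff_divide_distrib)
  ultimately show ?thesis by (simp add: B_def)
qed

text \<open>
  The continuation of zeta to \<open>Re s > 0\<close> that compares the series with the integral
  \<open>1/(s - 1)\<close> of \<open>x\<^sup>-\<^sup>s\<close> over \<open>[1, \<infinity>)\<close>. The eta
  function alone does not give it, since \<open>1 - 2\<^sup>1\<^sup>-\<^sup>s\<close> has further zeros on the line \<open>Re s = 1\<close>.
\<close>

definition zeta_right :: "complex \<Rightarrow> complex" where
  "zeta_right s = 1 / (s - 1) + (\<Sum>n. sum_minus_integral s (real (Suc n)))"

lemma zeta_right_holomorphic: "zeta_right holomorphic_on {s. Re s > 0} - {1}"
proof -
  define S where "S = {s. Re s > 0} - {1 :: complex}"
  have S: "open S" unfolding S_def by (intro open_Diff open_halfspace_Re_gt) auto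
  have "(\<lambda>s. \<Sum>n. sum_minus_integral s (real (Suc n))) holomorphic_on S"
  proof (rule holomorphic_on_suminf[OF S])
    show "(\<lambda>s. sum_minus_integral s (real (Suc n))) holomorphic_on S" for n
      unfolding sum_minus_integral_def by (intro holomorphic_intros) (auto simp: S_def)
    fix z assume z: "z \<in> S"
    define d where "d = Re z / 2"
    define h where "h = (\<lambda>n. (cmod z + d) * real (Suc n) powr (- 1 - d))"
    have d: "d > 0" using z by (simp add: d_def S_def)
    have "summable (\<lambda>n. real (Suc n) powr (- 1 - d))"
      using d by (subst summable_Suc_iff) (simp add: summable_real_powr_iff)
    then have "summable h" unfolding h_def by (intro summable_mult)
    moreover have "norm (sum_minus_integral w (real (Suc n))) \<le> h n" if w: "w \<in> ball z d \<inter> S" for n w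
    proof -
      have wz: "cmod (w - z) < d" using w by (simp add: dist_norm norm_minus_commute)
      then have "\<bar>Re w - Re z\<bar> < d" using abs_Re_le_cmod[of "w - z"] by simp
      then have Re: "Re w \<ge> d" unfolding d_def by (simp add: abs_if split: if_splits)
      have W: "cmod w \<le> cmod z + d" using wz norm_triangle_ineq2[of w z] by linarith
      have "norm (sum_minus_integral w (real (Suc n))) \<le> cmod w * real (Suc n) powr (- Re w - 1)"
        by (rule cmod_sum_minus_integral_le) (use w Re d in \<open>auto simp: S_def\<close>)
      also have "\<dots> \<le> h n"
        unfolding h_def using W Re d by (intro mult_mono powr_mono) auto
      finally show ?thesis .
    qed
    ultimately show "\<exists>d h. 0 < d \<and> summable h \<and>
        (\<forall>n. \<forall>w\<in>ball z d \<inter> S. norm (sum_minus_integral w (real (Suc n))) \<le> h n)"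
      using d by blast
  qed
  then show ?thesis
    unfolding zeta_right_def S_def[symmetric] by (intro holomorphic_intros) (auto simp: S_def)
qed

lemma zeta_right_eq_dirichlet:
  assumes s: "Re s > 1"
  shows "zeta_right s = dirichlet_zeta s"
proof -
  have "(\<lambda>n. of_nat (Suc n) powr (1 - s) :: complex) \<longlonglongrightarrow> 0"
  proof (rule tendsto_norm_zero_cancel)
    have "norm (of_nat (Suc n) powr (1 - s) :: complex) = real (Suc n) powr (1 - Re s)" for n
      using norm_powr_real_powr[of "complex_of_real (real (Suc n))" "1 - s"] by simp
    moreover have "(\<lambda>n. real (Suc n) powr (1 - Re s)) \<longlonglongrightarrow> 0"
      using s by (intro LIMSEQ_Suc[of "\<lambda>n. real n powr (1 - Re s)"] tendsto_neg_powr filterlim_real_sequentially) auto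
    ultimately show "(\<lambda>n. norm (of_nat (Suc n) powr (1 - s) :: complex)) \<longlonglongrightarrow> 0" by simp
  qed
  then have "(\<lambda>n. (of_nat (Suc (Suc n)) powr (1 - s) - of_nat (Suc n) powr (1 - s))) sums (0 - of_nat (Suc 0) powr (1 - s) :: complex)"
    by (rule telescope_sums)
  then have "(\<lambda>n. (of_nat (Suc (Suc n)) powr (1 - s) - of_nat (Suc n) powr (1 - s)) / (1 - s)) sums ((0 - of_nat (Suc 0) powr (1 - s)) / (1 - s) :: complex)"
    by (rule sums_divide)
  from sums_diff[OF dirichlet_zeta_sums(1)[OF s] this]
  have "(\<lambda>n. sum_minus_integral s (real (Suc n))) sums (dirichlet_zeta s + 1 / (1 - s))"
    by (simp add: sum_minus_integral_def add.commute)
  then have "zeta_right s = 1 / (s - 1) + (dirichlet_zeta s + 1 / (1 - s))"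
    by (simp add: zeta_right_def sums_iff)
  also have "1 / (1 - s) = - (1 / (s - 1))"
    by (metis minus_diff_eq minus_divide_right)
  also have "1 / (s - 1) + (dirichlet_zeta s + - (1 / (s - 1))) = dirichlet_zeta s"
    by simp
  finally show ?thesis .
qed

text \<open>
  The identity theorem: both sides are holomorphic on the punctured half-plane and agree for \<open>Re s > 1\<close>.
\<close>

lemma zeta_right_eq_eta:
  assumes s: "Re s > 0" "s \<noteq> 1"
  shows "(1 - 2 powr (1 - s)) * zeta_right s = eta_tail 1 s"
proof (rule analytic_continuation_open[of "{s. Re s > 1}" "{s. Re s > 0} - {1}"
      "\<lambda>s. (1 - 2 powr (1 - s)) * zeta_right s" "eta_tail 1"])
  show "open {s. 1 < Re s}" by (rule open_halfspace_Re_gt)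
  show "open ({s. 0 < Re s} - {1})" by (intro open_Diff open_halfspace_Re_gt) auto
  show "{s. 1 < Re s} \<noteq> {}" by (auto intro: exI[of _ 2])
  show "connected ({s. 0 < Re s} - {1})"
    by (intro connected_open_delete open_halfspace_Re_gt convex_connected convex_halfspace_Re_gt) auto
  show "(\<lambda>s. (1 - 2 powr (1 - s)) * zeta_right s) holomorphic_on {s. 0 < Re s} - {1}"
    by (intro holomorphic_intros zeta_right_holomorphic) auto
  show "eta_tail 1 holomorphic_on {s. 0 < Re s} - {1}"
    using eta_tail_holomorphic[of 1] by (rule holomorphic_on_subset) auto
  show "(1 - 2 powr (1 - z)) * zeta_right z = eta_tail 1 z" if "z \<in> {s. 1 < Re s}" for z
    using that eta_tail_1_eq_dirichlet[of z] zeta_right_eq_dirichlet[of z] by simp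
qed (use s in auto)

lemma two_powr_minus_1_ge:
  assumes "Re s < 1"
  shows "cmod (1 - 2 powr (1 - s)) \<ge> 2 powr (1 - Re s) - 1" "2 powr (1 - Re s) - 1 > 0"
    "1 - 2 powr (1 - s) \<noteq> 0"
proof -
  have "cmod (2 powr (1 - s)) = 2 powr (1 - Re s)"
    using norm_powr_real_powr[of 2 "1 - s"] by simp
  then show 1: "cmod (1 - 2 powr (1 - s)) \<ge> 2 powr (1 - Re s) - 1"
    using norm_triangle_ineq2[of "2 powr (1 - s)" 1] by (simp add: norm_minus_commute)
  show 2: "2 powr (1 - Re s) - 1 > 0" using assms by simp
  show "1 - 2 powr (1 - s) \<noteq> 0" using 1 2 by auto
qed

definition zeta_glued :: "complex \<Rightarrow> complex" where
  "zeta_glued s = (if s = 1 then 0 else if Re s > 0 then zeta_right s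
     else eta_tail 1 s / (1 - 2 powr (1 - s)))"

lemma zeta_glued_eq_eta:
  assumes "Re s < 1"
  shows "zeta_glued s = eta_tail 1 s / (1 - 2 powr (1 - s))"
  using assms zeta_right_eq_eta[of s] two_powr_minus_1_ge(3)[OF assms]
  by (auto simp: zeta_glued_def field_simps)

lemma zeta_glued_holomorphic: "zeta_glued holomorphic_on - {1}"
proof -
  have "zeta_glued holomorphic_on ({s. Re s > 0} - {1}) \<union> {s. Re s < 1}"
  proof (rule holomorphic_on_Un)
    show "zeta_glued holomorphic_on {s. Re s > 0} - {1}"
      by (rule holomorphic_transform[OF zeta_right_holomorphic]) (auto simp: zeta_glued_def)
    have "(\<lambda>s. eta_tail 1 s / (1 - 2 powr (1 - s))) holomorphic_on {s. Re s < 1}"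
      by (intro holomorphic_intros holomorphic_on_subset[OF eta_tail_holomorphic])
        (use two_powr_minus_1_ge(3) in auto)
    then show "zeta_glued holomorphic_on {s. Re s < 1}"
      by (rule holomorphic_transform) (simp add: zeta_glued_eq_eta)
    show "open ({s. Re s > 0} - {1 :: complex})" by (intro open_Diff open_halfspace_Re_gt) auto
    show "open {s. Re s < 1}" by (rule open_halfspace_Re_lt)
  qed
  then show ?thesis
    by (rule holomorphic_on_subset) (auto simp: not_less)
qed

text \<open>
  The two continuations glue to a function with the defining properties of zeta, and the identity
  theorem on the connected set \<open>- {1}\<close> makes it the only one.
\<close>

lemma zeta_eq_glued: "zeta = zeta_glued"
  unfolding zeta_def
proof (rule the_equality)
  show 1: "zeta_glued holomorphic_on - {1} \<and> (\<forall>s. Re s > 1 \<longrightarrow> zeta_glued s = dirichlet_zeta s) \<and> zeta_glued 1 = 0"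
    using zeta_glued_holomorphic zeta_right_eq_dirichlet by (auto simp: zeta_glued_def)
  fix f :: "complex \<Rightarrow> complex"
  assume f: "f holomorphic_on - {1} \<and> (\<forall>s. Re s > 1 \<longrightarrow> f s = dirichlet_zeta s) \<and> f 1 = 0"
  have "f s = zeta_glued s" if s: "s \<noteq> 1" for s
  proof (rule analytic_continuation_open[of "{s. Re s > 1}" "- {1}" f zeta_glued])
    show "open {s. 1 < Re s}" by (rule open_halfspace_Re_gt)
    show "{s. 1 < Re s} \<noteq> {}" by (auto intro: exI[of _ 2])
    show "connected (- {1 :: complex})" by (rule connected_punctured_universe) simp
  qed (use f 1 s in auto)
  then show "f = zeta_glued" using f 1 by (metis ext)
qed

lemma zeta_holomorphic: "zeta holomorphic_on - {1}"
  using zeta_glued_holomorphic by (simp add: zeta_eq_glued)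

lemma zeta_eq_eta:
  "Re s < 1 \<Longrightarrow> zeta s = eta_tail 1 s / (1 - 2 powr (1 - s))"
  using zeta_glued_eq_eta by (simp add: zeta_eq_glued)

lemma continuous_on_zeta_vertical:
  assumes "\<sigma> < 1"
  shows "continuous_on A (\<lambda>y. zeta (Complex \<sigma> y))"
proof (rule continuous_on_compose2[OF holomorphic_on_imp_continuous_on[OF zeta_holomorphic]])
  show "continuous_on A (\<lambda>y. Complex \<sigma> y)"
    unfolding Complex_eq by (intro continuous_intros)
qed (use assms in \<open>auto simp: complex_eq_iff\<close>)

lemma Re_zeta_of_real_pos:
  fixes x :: real
  assumes x: "x > 1"
  shows "Re (zeta (of_real x)) > 0"
proof -
  have "(\<lambda>n. Re (of_nat (Suc n) powr (- of_real x))) sums Re (dirichlet_zeta (of_real x))"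
    using x by (intro sums_Re dirichlet_zeta_sums) auto
  moreover have "Re (of_nat (Suc n) powr (- of_real x)) = real (Suc n) powr (- x)" for n
  proof -
    have "of_nat (Suc n) powr (- of_real x) = complex_of_real (real (Suc n) powr (- x))"
      using powr_of_real[of "real (Suc n)" "- x"] by simp
    then show ?thesis by simp
  qed
  ultimately have sums: "(\<lambda>n. real (Suc n) powr (- x)) sums Re (dirichlet_zeta (of_real x))" by simp
  have "zeta (of_real x) = dirichlet_zeta (of_real x)"
    using x zeta_right_eq_dirichlet[of "of_real x"] by (auto simp: zeta_eq_glued zeta_glued_def)
  moreover have "(\<Sum>n. real (Suc n) powr (- x)) > 0"
    using sums by (intro suminf_pos) (auto simp: sums_iff)
  ultimately show ?thesis using sums by (simp add: sums_iff)
qed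

section \<open>The mean square of zeta on a vertical line\<close>

lemma integral_exp_imaginary_bound:
  fixes w T :: real
  assumes w: "w \<noteq> 0"
  obtains J where "((\<lambda>y. exp (\<i> * of_real (y * w))) has_integral J) {0..T}" "cmod J \<le> 2 / \<bar>w\<bar>"
proof (cases "T \<ge> 0")
  case True
  define F where "F = (\<lambda>y. exp (\<i> * of_real (y * w)) / (\<i> * of_real w))"
  have "((\<lambda>y. exp (\<i> * of_real (y * w))) has_integral (F T - F 0)) {0..T}"
  proof (rule fundamental_theorem_of_calculus[OF True])
    fix y assume "y \<in> {0..T}"
    have "((\<lambda>z. exp (\<i> * (z * of_real w)) / (\<i> * of_real w)) has_field_derivative exp (\<i> * (of_real y * of_real w)))
        (at (of_real y))"
      using w by (auto intro!: derivative_eq_intros simp: field_simps)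
    from has_vector_derivative_real_field[OF this, of "{0..T}"]
    show "(F has_vector_derivative exp (\<i> * of_real (y * w))) (at y within {0..T})"
      by (simp add: F_def)
  qed
  moreover have "cmod (F T - F 0) \<le> cmod (F T) + cmod (F 0)" by (rule norm_triangle_ineq4)
  moreover have "cmod (F y) = 1 / \<bar>w\<bar>" for y
    by (simp add: F_def norm_divide norm_mult)
  ultimately show thesis using that by fastforce
next
  case False
  then have "((\<lambda>y. exp (\<i> * of_real (y * w))) has_integral 0) {0..T}"
    by (simp add: has_integral_empty_eq)
  then show thesis using that[of 0] by simp
qed

lemma inverse_log_ratio_le:
  assumes "0 < m" "0 < n" "m \<noteq> n"
  shows "1 / \<bar>ln (real m) - ln (real n)\<bar> \<le> real (max m n) / \<bar>real m - real n\<bar>"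
proof -
  have *: "1 / \<bar>ln (real m) - ln (real n)\<bar> \<le> real n / \<bar>real m - real n\<bar>"
    if "0 < m" "m < n" for m n :: nat
  proof -
    have "ln (real m / real n) \<le> real m / real n - 1"
      using that by (intro ln_le_minus_one) auto
    then have "(real n - real m) / real n \<le> ln (real n) - ln (real m)"
      using that by (simp add: ln_div diff_divide_distrib)
    moreover have "(real n - real m) / real n > 0" using that by simp
    ultimately have "1 / (ln (real n) - ln (real m)) \<le> 1 / ((real n - real m) / real n)"
      by (intro divide_left_mono mult_pos_pos) auto
    then show ?thesis using that by (simp add: abs_if)
  qed
  show ?thesis
  proof (cases "m < n")
    case True
    then show ?thesis using *[of m n] assms by (simp add: max_def)
  next
    case False
    then show ?thesis
      using *[of n m] assms by (simp add: max_def abs_minus_commute)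
  qed
qed

lemma harm_le: "harm n \<le> (1 + ln (real n) :: real)" if "n > 0"
  using that
proof (induction n rule: nat_induct_non_zero)
  case (Suc n)
  have "ln (real n / real (Suc n)) \<le> real n / real (Suc n) - 1"
    using Suc by (intro ln_le_minus_one) auto
  also have "\<dots> = - inverse (real (Suc n))" by (simp add: field_simps)
  finally show ?case using Suc by (simp add: harm_Suc ln_div)
qed (simp add: harm_def)

text \<open>
  Writing \<open>m = n + (m - n)\<close> for \<open>m > n\<close> shows that each term is at most \<open>1 + n/\<bar>m - n\<bar>\<close>.
\<close>

lemma sum_max_over_distance_le:
  assumes n: "n \<in> {1..<N}"
  shows "(\<Sum>m\<in>{1..<N} - {n}. real (max m n) / \<bar>real m - real n\<bar>) \<le> real N + 2 * real n * harm N"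
proof -
  have "(\<Sum>m\<in>{1..<N} - {n}. real (max m n) / \<bar>real m - real n\<bar>)
      \<le> (\<Sum>m\<in>{1..<N} - {n}. 1 + real n / \<bar>real m - real n\<bar>)"
  proof (rule sum_mono)
    fix m assume "m \<in> {1..<N} - {n}"
    then show "real (max m n) / \<bar>real m - real n\<bar> \<le> 1 + real n / \<bar>real m - real n\<bar>"
    proof (cases "m < n")
      case False
      then have "real m > real n" using \<open>m \<in> _\<close> by auto
      then show ?thesis by (simp add: max_def field_simps)
    qed (simp add: max_def)
  qed
  also have "\<dots> = real (card ({1..<N} - {n})) + real n * (\<Sum>m\<in>{1..<N} - {n}. 1 / \<bar>real m - real n\<bar>)"
    by (simp add: sum.distrib sum_distrib_left)
  also have "\<dots> \<le> real N + real n * (2 * harm N)"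
  proof (intro add_mono mult_left_mono)
    have "card ({1..<N} - {n}) \<le> card {1..<N}" by (intro card_mono) auto
    then show "real (card ({1..<N} - {n})) \<le> real N" by simp
    have split: "{1..<N} - {n} = {1..<n} \<union> {n<..<N}" using n by auto
    have "(\<Sum>m\<in>{1..<N} - {n}. 1 / \<bar>real m - real n\<bar>)
        = (\<Sum>m\<in>{1..<n}. 1 / \<bar>real m - real n\<bar>) + (\<Sum>m\<in>{n<..<N}. 1 / \<bar>real m - real n\<bar>)"
      unfolding split by (rule sum.union_disjoint) auto
    also have "(\<Sum>m\<in>{1..<n}. 1 / \<bar>real m - real n\<bar>) = (\<Sum>k\<in>{1..<n}. inverse (real k))"
      by (rule sum.reindex_bij_witness[of _ "\<lambda>k. n - k" "\<lambda>m. n - m"])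
        (auto simp: inverse_eq_divide)
    also have "\<dots> \<le> harm N"
      unfolding harm_def by (rule sum_mono2) (use n in auto)
    also have "(\<Sum>m\<in>{n<..<N}. 1 / \<bar>real m - real n\<bar>) = (\<Sum>k\<in>{1..<N - n}. inverse (real k))"
      by (rule sum.reindex_bij_witness[of _ "\<lambda>k. k + n" "\<lambda>m. m - n"])
        (auto simp: inverse_eq_divide)
    also have "\<dots> \<le> harm N"
      unfolding harm_def by (rule sum_mono2) (use n in auto)
    finally show "(\<Sum>m\<in>{1..<N} - {n}. 1 / \<bar>real m - real n\<bar>) \<le> 2 * harm N" by simp
  qed auto
  finally show ?thesis by (simp add: algebra_simps)
qed

text \<open>
  Expanding the square, a pair \<open>m \<noteq> n\<close> contributes an oscillating integral of size at most
  \<open>2/\<bar>ln (m/n)\<bar>\<close>, and \<open>\<bar>ln (m/n)\<bar> \<ge> \<bar>m - n\<bar>/max m n\<close>. This kernel is symmetric, so \<open>2 \<bar>a\<^sub>m a\<^sub>n\<bar> \<le> \<bar>a\<^sub>m\<bar>\<^sup>2 + \<bar>a\<^sub>n\<bar>\<^sup>2\<close>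
  leaves only its row sums. These are \<open>O(N + n ln N)\<close>. Having \<open>n\<close> instead of \<open>N\<close> in front of the
  logarithm avoids a second logarithm for the coefficients \<open>n\<^sup>-\<^sup>1\<^sup>/\<^sup>2\<close>.
\<close>

lemma dirichlet_polynomial_mean_square:
  fixes a :: "nat \<Rightarrow> complex" and T :: real and N :: nat
  assumes T: "T \<ge> 0"
  defines "S \<equiv> \<lambda>y. \<Sum>n\<in>{1..<N}. a n * exp (\<i> * of_real (y * ln (real n)))"
  shows "(\<lambda>y. (cmod (S y))\<^sup>2) integrable_on {0..T}"
    and "integral {0..T} (\<lambda>y. (cmod (S y))\<^sup>2)
      \<le> (\<Sum>n\<in>{1..<N}. (cmod (a n))\<^sup>2 * (T + 2 * (real N + 2 * real n * harm N)))"
proof -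
  let ?I = "{1..<N}"
  define w where "w = (\<lambda>m n. real (max m n) / \<bar>real m - real n\<bar>)"
  define E where "E = (\<lambda>m n y. exp (\<i> * of_real (y * (ln (real m) - ln (real n)))))"
  define B where "B = (\<lambda>m n. if m = n then T else 2 * w m n)"
  have "\<exists>J. (E m n has_integral J) {0..T} \<and> cmod J \<le> B m n" if "m \<in> ?I" "n \<in> ?I" for m n
  proof (cases "m = n")
    case True
    have "((\<lambda>y. 1 :: complex) has_integral of_real T) {0..T}"
      using has_integral_const_real[of "1 :: complex" 0 T] T by (simp add: scaleR_conv_of_real)
    then show ?thesis using True T by (intro exI[of _ "of_real T"]) (auto simp: E_def B_def)
  next
    case False
    then have "ln (real m) - ln (real n) \<noteq> 0" using that by auto
    then obtain J where J: "(E m n has_integral J) {0..T}" "cmod J \<le> 2 / \<bar>ln (real m) - ln (real n)\<bar>"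
      unfolding E_def using integral_exp_imaginary_bound by metis
    have "2 / \<bar>ln (real m) - ln (real n)\<bar> \<le> 2 * w m n"
      using inverse_log_ratio_le[of m n] that False by (simp add: w_def)
    then show ?thesis using J False by (auto simp: B_def intro!: exI[of _ J])
  qed
  then obtain J where J: "\<And>m n. m \<in> ?I \<Longrightarrow> n \<in> ?I \<Longrightarrow> (E m n has_integral J m n) {0..T}"
    "\<And>m n. m \<in> ?I \<Longrightarrow> n \<in> ?I \<Longrightarrow> cmod (J m n) \<le> B m n" by metis
  define V where "V = (\<Sum>m\<in>?I. \<Sum>n\<in>?I. a m * cnj (a n) * J m n)"
  have expand: "complex_of_real ((cmod (S y))\<^sup>2) = (\<Sum>m\<in>?I. \<Sum>n\<in>?I. a m * cnj (a n) * E m n y)" for y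
  proof -
    have "complex_of_real ((cmod (S y))\<^sup>2) = S y * cnj (S y)" by (rule complex_norm_square)
    also have "\<dots> = (\<Sum>m\<in>?I. \<Sum>n\<in>?I. (a m * exp (\<i> * of_real (y * ln (real m))))
        * cnj (a n * exp (\<i> * of_real (y * ln (real n)))))"
      unfolding S_def cnj_sum by (rule sum_product)
    also have "\<dots> = (\<Sum>m\<in>?I. \<Sum>n\<in>?I. a m * cnj (a n) * E m n y)"
    proof (intro sum.cong refl)
      fix m n
      have "exp (\<i> * of_real (y * ln (real m))) * cnj (exp (\<i> * of_real (y * ln (real n)))) = E m n y"
        by (simp add: E_def exp_cnj exp_add[symmetric] algebra_simps)
      then show "(a m * exp (\<i> * of_real (y * ln (real m)))) * cnj (a n * exp (\<i> * of_real (y * ln (real n))))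
          = a m * cnj (a n) * E m n y"
        by (simp add: mult_ac)
    qed
    finally show ?thesis .
  qed
  have "((\<lambda>y. \<Sum>m\<in>?I. \<Sum>n\<in>?I. a m * cnj (a n) * E m n y) has_integral V) {0..T}"
    unfolding V_def by (intro has_integral_sum has_integral_mult_right J) auto
  then have "((\<lambda>y. complex_of_real ((cmod (S y))\<^sup>2)) has_integral V) {0..T}"
    by (simp only: expand)
  from has_integral_linear[OF this bounded_linear_Re]
  have I: "((\<lambda>y. (cmod (S y))\<^sup>2) has_integral Re V) {0..T}"
    by (simp add: o_def)
  then show "(\<lambda>y. (cmod (S y))\<^sup>2) integrable_on {0..T}" by blast
  have "Re V \<le> cmod V" by (rule complex_Re_le_cmod)
  also have "\<dots> \<le> (\<Sum>m\<in>?I. \<Sum>n\<in>?I. cmod (a m) * cmod (a n) * B m n)"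
    unfolding V_def
    by (intro sum_norm_le) (auto simp: norm_mult intro!: mult_left_mono J)
  also have "\<dots> \<le> (\<Sum>m\<in>?I. \<Sum>n\<in>?I. ((cmod (a m))\<^sup>2 / 2 + (cmod (a n))\<^sup>2 / 2) * B m n)"
  proof (intro sum_mono mult_right_mono)
    fix m n
    show "cmod (a m) * cmod (a n) \<le> (cmod (a m))\<^sup>2 / 2 + (cmod (a n))\<^sup>2 / 2"
      using sum_squares_bound[of "cmod (a m)" "cmod (a n)"] by simp
    show "0 \<le> B m n" using T by (simp add: B_def w_def)
  qed
  also have "\<dots> = (\<Sum>m\<in>?I. \<Sum>n\<in>?I. (cmod (a m))\<^sup>2 / 2 * B m n) + (\<Sum>m\<in>?I. \<Sum>n\<in>?I. (cmod (a n))\<^sup>2 / 2 * B m n)"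
    by (simp only: distrib_right sum.distrib)
  also have "(\<Sum>m\<in>?I. \<Sum>n\<in>?I. (cmod (a m))\<^sup>2 / 2 * B m n) = (\<Sum>m\<in>?I. \<Sum>n\<in>?I. (cmod (a n))\<^sup>2 / 2 * B m n)"
  proof (subst sum.swap, intro sum.cong refl)
    fix m n
    show "(cmod (a m))\<^sup>2 / 2 * B m n = (cmod (a m))\<^sup>2 / 2 * B n m"
      by (simp add: B_def w_def max.commute abs_minus_commute)
  qed
  also have "(\<Sum>m\<in>?I. \<Sum>n\<in>?I. (cmod (a n))\<^sup>2 / 2 * B m n) + (\<Sum>m\<in>?I. \<Sum>n\<in>?I. (cmod (a n))\<^sup>2 / 2 * B m n)
      = (\<Sum>m\<in>?I. \<Sum>n\<in>?I. (cmod (a n))\<^sup>2 * B m n)"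
    by (simp add: sum.distrib[symmetric] mult.commute)
  also have "\<dots> = (\<Sum>n\<in>?I. (cmod (a n))\<^sup>2 * (\<Sum>m\<in>?I. B m n))"
    by (subst sum.swap) (simp only: sum_distrib_left)
  also have "\<dots> \<le> (\<Sum>n\<in>?I. (cmod (a n))\<^sup>2 * (T + 2 * (real N + 2 * real n * harm N)))"
  proof (intro sum_mono mult_left_mono)
    fix n assume n: "n \<in> ?I"
    have "(\<Sum>m\<in>?I. B m n) = B n n + (\<Sum>m\<in>?I - {n}. B m n)"
      using n by (intro sum.remove) auto
    also have "(\<Sum>m\<in>?I - {n}. B m n) = 2 * (\<Sum>m\<in>?I - {n}. w m n)"
      unfolding sum_distrib_left by (intro sum.cong) (auto simp: B_def)
    also have "\<dots> \<le> 2 * (real N + 2 * real n * harm N)"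
      using sum_max_over_distance_le[OF n] by (simp add: w_def)
    finally show "(\<Sum>m\<in>?I. B m n) \<le> T + 2 * (real N + 2 * real n * harm N)"
      by (simp add: B_def)
  qed auto
  finally show "integral {0..T} (\<lambda>y. (cmod (S y))\<^sup>2)
      \<le> (\<Sum>n\<in>{1..<N}. (cmod (a n))\<^sup>2 * (T + 2 * (real N + 2 * real n * harm N)))"
    using integral_unique[OF I] by simp
qed

text \<open>
  For \<open>0 \<le> y \<le> T\<close> and \<open>0 < \<sigma> < 1\<close> the modulus of \<open>\<sigma> + iy\<close> is at most \<open>T + 1\<close>. Thus \<open>N = 2\<^sup>K\<close> is long enough for
  the tail estimate of the eta function up to height \<open>T\<close>, and still comparable to \<open>T\<close>.
\<close>

lemma dyadic_length:
  fixes T :: real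
  assumes T: "T \<ge> 1"
  obtains K :: nat where "K \<ge> 2" "real K + (T + 1) \<le> 2 ^ K" "2 ^ K \<le> 8 * T"
proof -
  \<comment> \<open>One half of \<open>2\<^sup>K\<close> covers \<open>T + 1\<close>, the other half covers \<open>K\<close>.\<close>
  define K where "K = (LEAST K. 2 * T + 2 \<le> (2::real) ^ K)"
  obtain k :: nat where "2 * T + 2 < 2 ^ k" using real_arch_pow[of 2 "2 * T + 2"] by auto
  then have "2 * T + 2 \<le> 2 ^ k" by simp
  then have K: "2 * T + 2 \<le> 2 ^ K"
    unfolding K_def by (rule LeastI[of "\<lambda>K. 2 * T + 2 \<le> (2::real) ^ K" k])
  have K2: "K \<ge> 2"
  proof (rule ccontr)
    assume "\<not> K \<ge> 2"
    then have "(2::real) ^ K \<le> 2 ^ 1" by (intro power_increasing) auto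
    then show False using K T by simp
  qed
  then obtain k where k: "K = Suc k" by (cases K) auto
  have "\<not> 2 * T + 2 \<le> 2 ^ k"
  proof (rule not_less_Least)
    show "k < (LEAST K. 2 * T + 2 \<le> (2::real) ^ K)"
      unfolding K_def[symmetric] k by (rule lessI)
  qed
  then have up: "(2::real) ^ K \<le> 8 * T" using k T by simp
  have "Suc k \<le> 2 ^ k" by (rule Suc_leI[OF less_exp])
  then have "real K \<le> 2 ^ k" using k by (metis of_nat_le_iff of_nat_numeral of_nat_power)
  then have "real K + (T + 1) \<le> 2 ^ K" using K k by simp
  with K2 up that show thesis by blast
qed

text \<open>
  On the line \<open>Re s = \<sigma>\<close> the factor \<open>1 - 2\<^sup>1\<^sup>-\<^sup>s\<close> is bounded away from 0, so \<open>\<bar>\<zeta>\<bar>\<^sup>2\<close> is at most a constant times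
  \<open>\<bar>S\<bar>\<^sup>2 + 9\<close>, where \<open>S\<close> is the conjugate of the partial sum of the eta series up to \<open>N\<close> and 3 bounds the
  tail.
\<close>

lemma zeta_mean_square:
  assumes \<sigma>: "0 < \<sigma>" "\<sigma> < 1"
  obtains C where "C > 0"
    "\<And>T. T \<ge> 1 \<Longrightarrow> \<exists>N. T \<le> real N \<and> real N \<le> 8 * T \<and>
      integral {1..T} (\<lambda>y. (cmod (zeta (Complex \<sigma> y)))\<^sup>2)
      \<le> C * (real N * (\<Sum>n\<in>{1..<N}. real n powr (- 2 * \<sigma>))
            + (1 + ln (real N)) * (\<Sum>n\<in>{1..<N}. real n powr (1 - 2 * \<sigma>)))"
proof
  define q where "q = 2 powr (1 - \<sigma>) - 1"
  have q: "q > 0" using \<sigma> by (simp add: q_def)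
  define C where "C = 24 / q\<^sup>2"
  show "C > 0" using q by (simp add: C_def)
  fix T :: real assume T: "T \<ge> 1"
  obtain K where K: "K \<ge> 2" "real K + (T + 1) \<le> 2 ^ K" "2 ^ K \<le> 8 * T"
    using dyadic_length[OF T] .
  define N :: nat where "N = 2 ^ K"
  have N: "real N = 2 ^ K" by (simp add: N_def)
  have N2: "N \<ge> 2" using power_increasing[of 1 K "2::nat"] K by (simp add: N_def)
  define a where "a = (\<lambda>n. (- 1) ^ Suc n * complex_of_real (real n powr (- \<sigma>)))"
  define S where "S = (\<lambda>y. \<Sum>n\<in>{1..<N}. a n * exp (\<i> * of_real (y * ln (real n))))"
  define A where "A = (\<Sum>n\<in>{1..<N}. real n powr (- 2 * \<sigma>))"
  define B where "B = (\<Sum>n\<in>{1..<N}. real n powr (1 - 2 * \<sigma>))"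
  have na: "(cmod (a n))\<^sup>2 = real n powr (- 2 * \<sigma>)" if "n > 0" for n
    using that by (simp add: a_def norm_mult norm_power powr_power)
  have A1: "A \<ge> 1"
  proof -
    have "(\<Sum>n\<in>{1}. real n powr (- 2 * \<sigma>)) \<le> A"
      unfolding A_def by (rule sum_mono2) (use N2 in auto)
    then show ?thesis by simp
  qed
  have pw: "(cmod (zeta (Complex \<sigma> y)))\<^sup>2 \<le> (2 / q\<^sup>2) * ((cmod (S y))\<^sup>2 + 9)" if y: "y \<in> {1..T}" for y
  proof -
    define s where "s = Complex \<sigma> y"
    have Re: "Re s = \<sigma>" by (simp add: s_def)
    have cs: "cmod s + real K \<le> real N"
      using cmod_le[of s] y \<sigma> K by (simp add: s_def N)
    have tail: "cmod (eta_tail N s) \<le> 3"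
    proof -
      have "cmod (eta_tail N s) \<le> 3 * real N powr (- Re s)"
        by (rule cmod_eta_tail_le[OF K(1) N_def _ cs]) (use Re \<sigma> in simp)
      also have "real N powr (- Re s) \<le> real N powr 0"
        using N2 \<sigma> Re by (intro powr_mono) auto
      finally show ?thesis using N2 by simp
    qed
    \<comment> \<open>\<open>S\<close> has the frequencies \<open>ln n\<close> and \<open>n\<^sup>-\<^sup>s\<close> the opposite ones, whence the conjugate.\<close>
    have terms: "(- 1) ^ Suc n * of_nat n powr (- s) = cnj (a n * exp (\<i> * of_real (y * ln (real n))))"
      if "n \<in> {1..<N}" for n
    proof -
      have "of_nat n powr (- s) = exp (- s * of_real (ln (real n)))"
        using that by (simp add: powr_def)
      also have "- s * of_real (ln (real n)) = of_real (- \<sigma> * ln (real n)) + cnj (\<i> * of_real (y * ln (real n)))"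
        by (simp add: s_def complex_eq_iff)
      also have "exp \<dots> = of_real (real n powr (- \<sigma>)) * cnj (exp (\<i> * of_real (y * ln (real n))))"
        using that by (simp only: exp_add exp_of_real exp_cnj) (simp add: powr_def)
      finally show ?thesis by (simp add: a_def)
    qed
    have "eta_tail 1 s = (\<Sum>n\<in>{1..<N}. (- 1) ^ Suc n * of_nat n powr (- s)) + (- 1) ^ (N - 1) * eta_tail N s"
      using eta_eq_partial_sum_plus_tail[of s "N - 1"] N2 by simp
    also have "(\<Sum>n\<in>{1..<N}. (- 1) ^ Suc n * of_nat n powr (- s)) = cnj (S y)"
      unfolding S_def cnj_sum by (intro sum.cong refl terms)
    finally have "cmod (eta_tail 1 s) \<le> cmod (S y) + cmod (eta_tail N s)"
      using norm_triangle_ineq[of "cnj (S y)" "(- 1) ^ (N - 1) * eta_tail N s"]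
      by (simp add: norm_mult norm_power)
    with tail have eta: "cmod (eta_tail 1 s) \<le> cmod (S y) + 3" by linarith
    have den: "cmod (1 - 2 powr (1 - s)) \<ge> q"
      using two_powr_minus_1_ge(1)[of s] Re \<sigma> by (simp add: q_def)
    have "cmod (zeta s) = cmod (eta_tail 1 s) / cmod (1 - 2 powr (1 - s))"
      using zeta_eq_eta[of s] Re \<sigma> by (simp add: norm_divide)
    also have "\<dots> \<le> (cmod (S y) + 3) / q"
      using eta den q by (intro frac_le) auto
    finally have "(cmod (zeta s))\<^sup>2 \<le> ((cmod (S y) + 3) / q)\<^sup>2"
      by (intro power_mono) auto
    also have "\<dots> \<le> (2 * ((cmod (S y))\<^sup>2 + 9)) / q\<^sup>2"
      using sum_squares_bound[of "cmod (S y)" 3]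
      unfolding power_divide by (intro divide_right_mono) (auto simp: power2_eq_square algebra_simps)
    finally show ?thesis by (simp add: s_def)
  qed
  have intS: "(\<lambda>y. (cmod (S y))\<^sup>2) integrable_on {0..T}"
    and leS: "integral {0..T} (\<lambda>y. (cmod (S y))\<^sup>2)
      \<le> (\<Sum>n\<in>{1..<N}. (cmod (a n))\<^sup>2 * (T + 2 * (real N + 2 * real n * harm N)))"
    using dirichlet_polynomial_mean_square[of T a N] T unfolding S_def by auto
  have intS1: "(\<lambda>y. (cmod (S y))\<^sup>2) integrable_on {1..T}"
    by (rule integrable_on_subinterval[OF intS]) auto
  have TN: "T \<le> real N" using K by (simp add: N)
  have L: "harm N \<le> 1 + ln (real N)" using harm_le[of N] N2 by simp
  have B0: "B \<ge> 0" unfolding B_def by (intro sum_nonneg) auto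
  have "(\<Sum>n\<in>{1..<N}. (cmod (a n))\<^sup>2 * (T + 2 * (real N + 2 * real n * harm N)))
      \<le> (\<Sum>n\<in>{1..<N}. 3 * real N * real n powr (- 2 * \<sigma>) + 4 * harm N * real n powr (1 - 2 * \<sigma>))"
  proof (rule sum_mono)
    fix n assume n: "n \<in> {1..<N}"
    have "real n * real n powr (- 2 * \<sigma>) = real n powr (1 - 2 * \<sigma>)"
      using n powr_add[of "real n" 1 "- 2 * \<sigma>"] by simp
    moreover have "T * real n powr (- 2 * \<sigma>) \<le> real N * real n powr (- 2 * \<sigma>)"
      using TN by (intro mult_right_mono) auto
    moreover have "real n powr (- 2 * \<sigma>) * (T + 2 * (real N + 2 * real n * harm N))
        = T * real n powr (- 2 * \<sigma>) + 2 * (real N * real n powr (- 2 * \<sigma>))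
          + 4 * harm N * (real n * real n powr (- 2 * \<sigma>))"
      by (simp only: distrib_left distrib_right mult_ac)
    ultimately show "(cmod (a n))\<^sup>2 * (T + 2 * (real N + 2 * real n * harm N))
        \<le> 3 * real N * real n powr (- 2 * \<sigma>) + 4 * harm N * real n powr (1 - 2 * \<sigma>)"
      using n na[of n] by simp
  qed
  also have "\<dots> = 3 * real N * A + 4 * harm N * B"
    unfolding A_def B_def by (simp add: sum.distrib sum_distrib_left)
  also have "\<dots> \<le> 3 * real N * A + 4 * (1 + ln (real N)) * B"
    using L B0 by (intro add_left_mono mult_right_mono) auto
  finally have S2: "integral {0..T} (\<lambda>y. (cmod (S y))\<^sup>2) \<le> 3 * real N * A + 4 * (1 + ln (real N)) * B"
    using leS by linarith
  have "integral {1..T} (\<lambda>y. (cmod (zeta (Complex \<sigma> y)))\<^sup>2)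
      \<le> integral {1..T} (\<lambda>y. (2 / q\<^sup>2) * ((cmod (S y))\<^sup>2 + 9))"
  proof (rule integral_le)
    show "(\<lambda>y. (cmod (zeta (Complex \<sigma> y)))\<^sup>2) integrable_on {1..T}"
      by (intro integrable_continuous_interval continuous_intros continuous_on_zeta_vertical \<sigma>)
    show "(\<lambda>y. (2 / q\<^sup>2) * ((cmod (S y))\<^sup>2 + 9)) integrable_on {1..T}"
      by (intro integrable_on_mult_right integrable_add intS1) auto
  qed (rule pw)
  also have "\<dots> = (2 / q\<^sup>2) * (integral {1..T} (\<lambda>y. (cmod (S y))\<^sup>2) + 9 * (T - 1))"
  proof (rule integral_unique, intro has_integral_mult_right has_integral_add)
    show "((\<lambda>y. (cmod (S y))\<^sup>2) has_integral integral {1..T} (\<lambda>y. (cmod (S y))\<^sup>2)) {1..T}"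
      by (rule integrable_integral[OF intS1])
    show "((\<lambda>y. 9) has_integral 9 * (T - 1)) {1..T}"
      using has_integral_const_real[of "9::real" 1 T] T by (simp add: mult.commute)
  qed
  also have "\<dots> \<le> (2 / q\<^sup>2) * ((3 * real N * A + 4 * (1 + ln (real N)) * B) + 9 * (real N * A))"
  proof (intro mult_left_mono add_mono)
    have "integral {1..T} (\<lambda>y. (cmod (S y))\<^sup>2) \<le> integral {0..T} (\<lambda>y. (cmod (S y))\<^sup>2)"
      by (rule integral_subset_le) (use intS intS1 in auto)
    then show "integral {1..T} (\<lambda>y. (cmod (S y))\<^sup>2) \<le> 3 * real N * A + 4 * (1 + ln (real N)) * B"
      using S2 by linarith
    have "T - 1 \<le> real N * 1" using TN by simp
    also have "\<dots> \<le> real N * A" using A1 by (intro mult_left_mono) auto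
    finally show "T - 1 \<le> real N * A" .
  qed auto
  also have "\<dots> \<le> (2 / q\<^sup>2) * (12 * (real N * A + (1 + ln (real N)) * B))"
  proof (rule mult_left_mono)
    have "(1 + ln (real N)) * B \<ge> 0" using B0 N2 by (intro mult_nonneg_nonneg add_nonneg_nonneg) auto
    then show "(3 * real N * A + 4 * (1 + ln (real N)) * B) + 9 * (real N * A)
        \<le> 12 * (real N * A + (1 + ln (real N)) * B)"
      by (simp add: algebra_simps)
  qed auto
  also have "\<dots> = C * (real N * A + (1 + ln (real N)) * B)" by (simp add: C_def)
  finally show "\<exists>N. T \<le> real N \<and> real N \<le> 8 * T \<and>
      integral {1..T} (\<lambda>y. (cmod (zeta (Complex \<sigma> y)))\<^sup>2)
      \<le> C * (real N * (\<Sum>n\<in>{1..<N}. real n powr (- 2 * \<sigma>))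
            + (1 + ln (real N)) * (\<Sum>n\<in>{1..<N}. real n powr (1 - 2 * \<sigma>)))"
    using TN K(3) N unfolding A_def B_def by (intro exI[of _ N]) auto
qed

section \<open>Mean square bounds with and without the weight\<close>

text \<open>
  Comparison with the harmonic sum by \<open>n\<^sup>1\<^sup>-\<^sup>a \<le> N\<^sup>1\<^sup>-\<^sup>a\<close>.
\<close>

lemma sum_powr_minus_le:
  assumes a: "a \<le> 1" and N: "N > 0"
  shows "(\<Sum>n\<in>{1..<N}. real n powr (- a)) \<le> real N powr (1 - a) * (1 + ln (real N))"
proof -
  have "(\<Sum>n\<in>{1..<N}. real n powr (- a)) \<le> (\<Sum>n\<in>{1..<N}. real N powr (1 - a) * inverse (real n))"
  proof (rule sum_mono)
    fix n assume n: "n \<in> {1..<N}"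
    then have "real n powr (- a) = real n powr (1 - a) * inverse (real n)"
      using powr_add[of "real n" "1 - a" "- 1"] by (simp add: powr_minus)
    also have "\<dots> \<le> real N powr (1 - a) * inverse (real n)"
      using n a by (intro mult_right_mono powr_mono2) auto
    finally show "real n powr (- a) \<le> real N powr (1 - a) * inverse (real n)" .
  qed
  also have "\<dots> = real N powr (1 - a) * (\<Sum>n\<in>{1..<N}. inverse (real n))"
    by (simp only: sum_distrib_left)
  also have "\<dots> \<le> real N powr (1 - a) * harm N"
    unfolding harm_def by (intro mult_left_mono sum_mono2) auto
  also have "\<dots> \<le> real N powr (1 - a) * (1 + ln (real N))"
    using harm_le[OF N] by (intro mult_left_mono) auto
  finally show ?thesis .
qed

text \<open>
  Here \<open>n\<^sup>1\<^sup>-\<^sup>2\<^sup>\<sigma>\<close> is at most \<open>N\<^sup>1\<^sup>-\<^sup>2\<^sup>\<sigma>\<close>, so both parts of the general bound are \<open>O(N\<^sup>2\<^sup>-\<^sup>2\<^sup>\<sigma> ln N)\<close> with a single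
  logarithm, also at \<open>\<sigma> = 1/2\<close>.
\<close>

lemma zeta_mean_square_left:
  assumes \<sigma>: "0 < \<sigma>" "\<sigma> \<le> 1 / 2"
  obtains C where "C > 0"
    "\<And>T. T \<ge> 1 \<Longrightarrow> integral {1..T} (\<lambda>y. (cmod (zeta (Complex \<sigma> y)))\<^sup>2)
      \<le> C * (T powr (2 - 2 * \<sigma>) * (1 + ln T))"
proof -
  obtain C where C: "C > 0" and le: "\<And>T. T \<ge> 1 \<Longrightarrow> \<exists>N. T \<le> real N \<and> real N \<le> 8 * T \<and>
      integral {1..T} (\<lambda>y. (cmod (zeta (Complex \<sigma> y)))\<^sup>2)
      \<le> C * (real N * (\<Sum>n\<in>{1..<N}. real n powr (- 2 * \<sigma>))
            + (1 + ln (real N)) * (\<Sum>n\<in>{1..<N}. real n powr (1 - 2 * \<sigma>)))"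
    using zeta_mean_square[of \<sigma>] \<sigma> by auto
  have "integral {1..T} (\<lambda>y. (cmod (zeta (Complex \<sigma> y)))\<^sup>2)
      \<le> C * 2 * 64 * 8 * (T powr (2 - 2 * \<sigma>) * (1 + ln T))" if T: "T \<ge> 1" for T
  proof -
    obtain N where N: "T \<le> real N" "real N \<le> 8 * T" and I: "integral {1..T} (\<lambda>y. (cmod (zeta (Complex \<sigma> y)))\<^sup>2)
      \<le> C * (real N * (\<Sum>n\<in>{1..<N}. real n powr (- 2 * \<sigma>))
            + (1 + ln (real N)) * (\<Sum>n\<in>{1..<N}. real n powr (1 - 2 * \<sigma>)))"
      using le[OF T] by blast
    have N0: "real N \<ge> 1" using N T by linarith
    define M where "M = real N powr (2 - 2 * \<sigma>)"
    have M: "M = real N * real N powr (1 - 2 * \<sigma>)"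
      using N0 powr_add[of "real N" 1 "1 - 2 * \<sigma>"] by (simp add: M_def)
    have "(\<Sum>n\<in>{1..<N}. real n powr (- 2 * \<sigma>)) \<le> real N powr (1 - 2 * \<sigma>) * (1 + ln (real N))"
      using sum_powr_minus_le[of "2 * \<sigma>" N] \<sigma> N0 by simp
    then have 1: "real N * (\<Sum>n\<in>{1..<N}. real n powr (- 2 * \<sigma>)) \<le> M * (1 + ln (real N))"
      unfolding M mult.assoc by (rule mult_left_mono) simp
    have "(\<Sum>n\<in>{1..<N}. real n powr (1 - 2 * \<sigma>)) \<le> (\<Sum>n\<in>{1..<N}. real N powr (1 - 2 * \<sigma>))"
      using \<sigma> by (intro sum_mono powr_mono2) auto
    also have "\<dots> \<le> M" using N0 by (simp add: M mult_right_mono)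
    finally have 2: "(1 + ln (real N)) * (\<Sum>n\<in>{1..<N}. real n powr (1 - 2 * \<sigma>)) \<le> (1 + ln (real N)) * M"
      using N0 by (intro mult_left_mono) auto
    have le8: "ln (real N) \<le> ln (8 * T)" using N N0 T by simp
    define c where "c = ln (8 :: real)"
    have "ln (8 * T) = c + ln T" using T by (simp add: ln_mult c_def)
    with le8 have "ln (real N) \<le> c + ln T" by simp
    moreover have "c \<le> 8 - 1" unfolding c_def by (rule ln_le_minus_one) simp
    moreover have "0 \<le> ln T" using T by simp
    ultimately have L: "1 + ln (real N) \<le> 8 * (1 + ln T)" by (simp add: algebra_simps)
    have "M \<le> (8 * T) powr (2 - 2 * \<sigma>)"
      unfolding M_def using N N0 \<sigma> by (intro powr_mono2) auto
    also have "\<dots> = 8 powr (2 - 2 * \<sigma>) * T powr (2 - 2 * \<sigma>)" using T by (simp add: powr_mult)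
    also have "8 powr (2 - 2 * \<sigma>) \<le> (8 :: real) powr 2" using \<sigma> by (intro powr_mono) auto
    finally have M2: "M \<le> 64 * T powr (2 - 2 * \<sigma>)" by (simp add: mult_right_mono)
    have "M * (1 + ln (real N)) \<le> (64 * T powr (2 - 2 * \<sigma>)) * (8 * (1 + ln T))"
      using M2 L N0 by (intro mult_mono) auto
    then have "M * (1 + ln (real N)) \<le> 64 * 8 * (T powr (2 - 2 * \<sigma>) * (1 + ln T))"
      by (simp only: mult_ac)
    moreover have "(1 + ln (real N)) * M = M * (1 + ln (real N))" by (rule mult.commute)
    ultimately have "real N * (\<Sum>n\<in>{1..<N}. real n powr (- 2 * \<sigma>))
            + (1 + ln (real N)) * (\<Sum>n\<in>{1..<N}. real n powr (1 - 2 * \<sigma>))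
          \<le> 2 * 64 * 8 * (T powr (2 - 2 * \<sigma>) * (1 + ln T))"
      using 1 2 by linarith
    from order_trans[OF I mult_left_mono[OF this, of C]] C show ?thesis
      by (simp only: mult.assoc less_imp_le)
  qed
  then show thesis using that[of "C * 2 * 64 * 8"] C by simp
qed

text \<open>
  Here the sum of \<open>n\<^sup>-\<^sup>2\<^sup>\<sigma>\<close> converges, and the off-diagonal part \<open>O(N\<^sup>2\<^sup>-\<^sup>2\<^sup>\<sigma> (ln N)\<^sup>2)\<close> is \<open>O(N)\<close> because \<open>2 - 2\<sigma> < 1\<close>.
\<close>

lemma zeta_mean_square_right:
  assumes \<sigma>: "1 / 2 < \<sigma>" "\<sigma> < 1"
  obtains C where "C > 0"
    "\<And>T. T \<ge> 1 \<Longrightarrow> integral {1..T} (\<lambda>y. (cmod (zeta (Complex \<sigma> y)))\<^sup>2) \<le> C * T"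
proof -
  obtain C where C: "C > 0" and le: "\<And>T. T \<ge> 1 \<Longrightarrow> \<exists>N. T \<le> real N \<and> real N \<le> 8 * T \<and>
      integral {1..T} (\<lambda>y. (cmod (zeta (Complex \<sigma> y)))\<^sup>2)
      \<le> C * (real N * (\<Sum>n\<in>{1..<N}. real n powr (- 2 * \<sigma>))
            + (1 + ln (real N)) * (\<Sum>n\<in>{1..<N}. real n powr (1 - 2 * \<sigma>)))"
    using zeta_mean_square[of \<sigma>] \<sigma> by auto
  \<comment> \<open>Two logarithms are traded for \<open>N\<^sup>2\<^sup>e = N\<^sup>2\<^sup>\<sigma>\<^sup>-\<^sup>1\<close>.\<close>
  define e where "e = (2 * \<sigma> - 1) / 2"
  have e: "e > 0" using \<sigma> by (simp add: e_def)
  have sm: "summable (\<lambda>n. real n powr (- 2 * \<sigma>))" using \<sigma> by (simp add: summable_real_powr_iff)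
  define Z where "Z = (\<Sum>n. real n powr (- 2 * \<sigma>))"
  have Z: "Z \<ge> 0" unfolding Z_def by (intro suminf_nonneg sm) auto
  define D where "D = Z + (1 + 1 / e)\<^sup>2"
  have D: "D > 0" unfolding D_def using Z e by (intro add_nonneg_pos zero_less_power) (auto intro: add_pos_pos)
  have "integral {1..T} (\<lambda>y. (cmod (zeta (Complex \<sigma> y)))\<^sup>2) \<le> C * D * 8 * T" if T: "T \<ge> 1" for T
  proof -
    obtain N where N: "T \<le> real N" "real N \<le> 8 * T" and I: "integral {1..T} (\<lambda>y. (cmod (zeta (Complex \<sigma> y)))\<^sup>2)
      \<le> C * (real N * (\<Sum>n\<in>{1..<N}. real n powr (- 2 * \<sigma>))
            + (1 + ln (real N)) * (\<Sum>n\<in>{1..<N}. real n powr (1 - 2 * \<sigma>)))"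
      using le[OF T] by blast
    have N0: "real N \<ge> 1" using N T by linarith
    have "(\<Sum>n\<in>{1..<N}. real n powr (- 2 * \<sigma>)) \<le> Z"
      unfolding Z_def by (rule sum_le_suminf[OF sm]) auto
    then have 1: "real N * (\<Sum>n\<in>{1..<N}. real n powr (- 2 * \<sigma>)) \<le> real N * Z"
      by (rule mult_left_mono) simp
    define L where "L = 1 + ln (real N)"
    have L0: "L \<ge> 0" using N0 by (simp add: L_def)
    have "ln (real N) \<le> real N powr e / e" by (rule ln_powr_bound[OF N0 e])
    moreover have "1 \<le> real N powr e" using N0 e by (simp add: ge_one_powr_ge_zero)
    ultimately have "L \<le> (1 + 1 / e) * real N powr e"
      unfolding L_def by (simp add: algebra_simps)
    then have "L\<^sup>2 \<le> ((1 + 1 / e) * real N powr e)\<^sup>2" using L0 by (intro power_mono)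
    also have "\<dots> = (1 + 1 / e)\<^sup>2 * real N powr (2 * \<sigma> - 1)"
    proof -
      have "(real N powr e)\<^sup>2 = real N powr (2 * \<sigma> - 1)"
        by (simp add: power2_eq_square powr_add[symmetric] e_def)
      then show ?thesis by (simp only: power_mult_distrib)
    qed
    finally have L2: "L\<^sup>2 \<le> (1 + 1 / e)\<^sup>2 * real N powr (2 * \<sigma> - 1)" .
    have "(\<Sum>n\<in>{1..<N}. real n powr (1 - 2 * \<sigma>)) \<le> real N powr (2 - 2 * \<sigma>) * L"
      using sum_powr_minus_le[of "2 * \<sigma> - 1" N] \<sigma> N0 by (simp add: L_def)
    then have "L * (\<Sum>n\<in>{1..<N}. real n powr (1 - 2 * \<sigma>)) \<le> L * (real N powr (2 - 2 * \<sigma>) * L)"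
      using L0 by (intro mult_left_mono)
    also have "\<dots> = real N powr (2 - 2 * \<sigma>) * L\<^sup>2" by (simp add: power2_eq_square)
    also have "\<dots> \<le> real N powr (2 - 2 * \<sigma>) * ((1 + 1 / e)\<^sup>2 * real N powr (2 * \<sigma> - 1))"
      using L2 by (intro mult_left_mono) auto
    also have "\<dots> = (1 + 1 / e)\<^sup>2 * (real N powr (2 - 2 * \<sigma>) * real N powr (2 * \<sigma> - 1))" by simp
    also have "real N powr (2 - 2 * \<sigma>) * real N powr (2 * \<sigma> - 1) = real N"
      using N0 by (simp add: powr_add[symmetric])
    finally have "L * (\<Sum>n\<in>{1..<N}. real n powr (1 - 2 * \<sigma>)) \<le> (1 + 1 / e)\<^sup>2 * real N" .
    with 1 have "real N * (\<Sum>n\<in>{1..<N}. real n powr (- 2 * \<sigma>)) + L * (\<Sum>n\<in>{1..<N}. real n powr (1 - 2 * \<sigma>)) \<le> D * real N"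
      unfolding D_def by (simp add: algebra_simps)
    also have "\<dots> \<le> D * (8 * T)" using N D by (intro mult_left_mono) auto
    finally have "C * (real N * (\<Sum>n\<in>{1..<N}. real n powr (- 2 * \<sigma>)) + L * (\<Sum>n\<in>{1..<N}. real n powr (1 - 2 * \<sigma>))) \<le> C * (D * (8 * T))"
      using C by (intro mult_left_mono) auto
    then show ?thesis using I unfolding L_def by (simp add: mult_ac)
  qed
  then show thesis using that[of "C * D * 8"] C D by simp
qed

definition weighted_mean_square :: "real \<Rightarrow> real \<Rightarrow> real" where
  "weighted_mean_square \<sigma> T = integral {1..T} (\<lambda>y. y powr (\<sigma> - 1 / 2) * (cmod (zeta (Complex \<sigma> y)))\<^sup>2)"

lemma weighted_integrand_continuous:
  assumes "\<sigma> < 1" "0 < a"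
  shows "continuous_on {a..b} (\<lambda>y. y powr (\<sigma> - 1 / 2) * (cmod (zeta (Complex \<sigma> y)))\<^sup>2)"
  using assms by (intro continuous_intros continuous_on_zeta_vertical) auto

lemma weighted_integral_le:
  assumes \<sigma>: "\<sigma> < 1" and a: "0 < a"
    and w: "\<And>y. a \<le> y \<Longrightarrow> y \<le> b \<Longrightarrow> y powr (\<sigma> - 1 / 2) \<le> w"
  shows "integral {a..b} (\<lambda>y. y powr (\<sigma> - 1 / 2) * (cmod (zeta (Complex \<sigma> y)))\<^sup>2)
    \<le> w * integral {a..b} (\<lambda>y. (cmod (zeta (Complex \<sigma> y)))\<^sup>2)"
proof -
  have "integral {a..b} (\<lambda>y. y powr (\<sigma> - 1 / 2) * (cmod (zeta (Complex \<sigma> y)))\<^sup>2)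
    \<le> integral {a..b} (\<lambda>y. w * (cmod (zeta (Complex \<sigma> y)))\<^sup>2)"
  proof (rule integral_le)
    show "(\<lambda>y. y powr (\<sigma> - 1 / 2) * (cmod (zeta (Complex \<sigma> y)))\<^sup>2) integrable_on {a..b}"
      by (intro integrable_continuous_interval weighted_integrand_continuous \<sigma> a)
    show "(\<lambda>y. w * (cmod (zeta (Complex \<sigma> y)))\<^sup>2) integrable_on {a..b}"
      by (intro integrable_continuous_interval continuous_intros continuous_on_zeta_vertical \<sigma>)
    show "y powr (\<sigma> - 1 / 2) * (cmod (zeta (Complex \<sigma> y)))\<^sup>2 \<le> w * (cmod (zeta (Complex \<sigma> y)))\<^sup>2"
      if "y \<in> {a..b}" for y
      using w[of y] that by (intro mult_right_mono) auto
  qed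
  then show ?thesis by simp
qed

lemma weighted_mean_square_right:
  assumes \<sigma>: "1 / 2 < \<sigma>" "\<sigma> < 1"
  obtains C where "C > 0" "\<And>T. T \<ge> 1 \<Longrightarrow> weighted_mean_square \<sigma> T \<le> C * T powr (\<sigma> + 1 / 2)"
proof -
  obtain C where C: "C > 0"
    "\<And>T. T \<ge> 1 \<Longrightarrow> integral {1..T} (\<lambda>y. (cmod (zeta (Complex \<sigma> y)))\<^sup>2) \<le> C * T"
    using zeta_mean_square_right[OF \<sigma>] by blast
  have "weighted_mean_square \<sigma> T \<le> C * T powr (\<sigma> + 1 / 2)" if T: "T \<ge> 1" for T
  proof -
    have "weighted_mean_square \<sigma> T \<le> T powr (\<sigma> - 1 / 2) * integral {1..T} (\<lambda>y. (cmod (zeta (Complex \<sigma> y)))\<^sup>2)"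
      unfolding weighted_mean_square_def
      by (rule weighted_integral_le) (use \<sigma> in \<open>auto intro!: powr_mono2\<close>)
    also have "\<dots> \<le> T powr (\<sigma> - 1 / 2) * (C * T)"
      by (intro mult_left_mono C(2) T) auto
    also have "\<dots> = C * T powr (\<sigma> + 1 / 2)"
      using T powr_add[of T "\<sigma> - 1 / 2" 1] by (simp add: add.commute)
    finally show ?thesis .
  qed
  with C(1) show thesis using that by blast
qed

lemma weighted_mean_square_half:
  obtains C where "C > 0" "\<And>T. T \<ge> 1 \<Longrightarrow> weighted_mean_square (1 / 2) T \<le> C * (T * (1 + ln T))"
proof -
  obtain C where C: "C > 0"
    "\<And>T. T \<ge> 1 \<Longrightarrow> integral {1..T} (\<lambda>y. (cmod (zeta (Complex (1 / 2) y)))\<^sup>2)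
      \<le> C * (T powr (2 - 2 * (1 / 2)) * (1 + ln T))"
    using zeta_mean_square_left[of "1 / 2"] by auto
  have "weighted_mean_square (1 / 2) T \<le> C * (T * (1 + ln T))" if T: "T \<ge> 1" for T
  proof -
    have "weighted_mean_square (1 / 2) T \<le> 1 * integral {1..T} (\<lambda>y. (cmod (zeta (Complex (1 / 2) y)))\<^sup>2)"
      unfolding weighted_mean_square_def by (rule weighted_integral_le) auto
    then show ?thesis using C(2)[OF T] T by simp
  qed
  with C(1) show thesis using that by blast
qed

text \<open>
  The weight \<open>y\<^sup>\<sigma>\<^sup>-\<^sup>1\<^sup>/\<^sup>2\<close> decays, which pays for the logarithm in the mean square. Below \<open>sqrt T\<close> the weight is
  at most 1 and the shorter range saves a power of \<open>T\<close>. Above \<open>sqrt T\<close> the weight itself does.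
\<close>

lemma weighted_mean_square_left:
  assumes \<sigma>: "0 < \<sigma>" "\<sigma> < 1 / 2"
  obtains C where "C > 0" "\<And>T. T \<ge> 1 \<Longrightarrow> weighted_mean_square \<sigma> T \<le> C * T powr (2 - 2 * \<sigma>)"
proof -
  obtain C where C: "C > 0"
    "\<And>T. T \<ge> 1 \<Longrightarrow> integral {1..T} (\<lambda>y. (cmod (zeta (Complex \<sigma> y)))\<^sup>2)
      \<le> C * (T powr (2 - 2 * \<sigma>) * (1 + ln T))"
    using zeta_mean_square_left[of \<sigma>] \<sigma> by auto
  \<comment> \<open>The power of \<open>T\<close> saved by the weight at \<open>sqrt T\<close>.\<close>
  define \<epsilon> where "\<epsilon> = (1 / 2 - \<sigma>) / 2"
  have \<epsilon>: "\<epsilon> > 0" "\<epsilon> \<le> 1 - \<sigma>" using \<sigma> by (auto simp: \<epsilon>_def)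
  have "weighted_mean_square \<sigma> T \<le> C * 2 * (1 + 1 / \<epsilon>) * T powr (2 - 2 * \<sigma>)" if T: "T \<ge> 1" for T
  proof -
    \<comment> \<open>Any power of \<open>T\<close> with exponent strictly between 0 and 1 could mark the division.\<close>
    define R where "R = sqrt T"
    define g where "g = (\<lambda>y. y powr (\<sigma> - 1 / 2) * (cmod (zeta (Complex \<sigma> y)))\<^sup>2)"
    define h where "h = (\<lambda>y. (cmod (zeta (Complex \<sigma> y)))\<^sup>2)"
    have R: "1 \<le> R" "R \<le> T" using T unfolding R_def
      by (auto simp: real_sqrt_le_iff intro!: real_le_lsqrt self_le_power)
    have hc: "h integrable_on {a..b}" for a b
      unfolding h_def
      using \<sigma> by (intro integrable_continuous_interval continuous_intros continuous_on_zeta_vertical) auto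
    have h0: "h y \<ge> 0" for y by (simp add: h_def)
    have split: "weighted_mean_square \<sigma> T = integral {1..R} g + integral {R..T} g"
      unfolding weighted_mean_square_def g_def[symmetric]
    proof (rule Henstock_Kurzweil_Integration.integral_combine[symmetric, OF R])
      show "g integrable_on {1..T}"
        unfolding g_def using \<sigma>
        by (intro integrable_continuous_interval weighted_integrand_continuous) auto
    qed
    have "integral {1..R} g \<le> 1 * integral {1..R} h"
      unfolding g_def h_def
    proof (rule weighted_integral_le)
      show "y powr (\<sigma> - 1 / 2) \<le> 1" if "1 \<le> y" for y
        using powr_mono[of "\<sigma> - 1 / 2" 0 y] that \<sigma> by simp
    qed (use \<sigma> in auto)
    also have "\<dots> \<le> C * (R powr (2 - 2 * \<sigma>) * (1 + ln R))"
      using C(2)[OF R(1)] by (simp add: h_def)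
    also have "R powr (2 - 2 * \<sigma>) = T powr (1 - \<sigma>)"
      using T by (simp add: R_def powr_half_sqrt[symmetric] powr_powr algebra_simps)
    also have "C * (T powr (1 - \<sigma>) * (1 + ln R)) \<le> C * (T powr (2 - 2 * \<sigma> - \<epsilon>) * (1 + ln T))"
    proof (intro mult_left_mono mult_mono)
      show "T powr (1 - \<sigma>) \<le> T powr (2 - 2 * \<sigma> - \<epsilon>)"
        using T \<epsilon> by (intro powr_mono) auto
      show "1 + ln R \<le> 1 + ln T" using R by simp
    qed (use R C in auto)
    finally have part1: "integral {1..R} g \<le> C * (T powr (2 - 2 * \<sigma> - \<epsilon>) * (1 + ln T))" .
    have "integral {R..T} g \<le> T powr (- \<epsilon>) * integral {R..T} h"
      unfolding g_def h_def
    proof (rule weighted_integral_le)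
      fix y assume y: "R \<le> y"
      have "y powr (\<sigma> - 1 / 2) \<le> R powr (\<sigma> - 1 / 2)"
        using y R \<sigma> by (intro powr_mono2') auto
      also have "\<dots> = T powr (- \<epsilon>)"
      proof -
        have "1 / 2 * (\<sigma> - 1 / 2) = - \<epsilon>" unfolding \<epsilon>_def by argo
        then show ?thesis using T by (simp only: R_def powr_half_sqrt[symmetric] powr_powr)
      qed
      finally show "y powr (\<sigma> - 1 / 2) \<le> T powr (- \<epsilon>)" .
    qed (use \<sigma> R in auto)
    also have "\<dots> \<le> T powr (- \<epsilon>) * integral {1..T} h"
      using R h0 by (intro mult_left_mono integral_subset_le hc) auto
    also have "\<dots> \<le> T powr (- \<epsilon>) * (C * (T powr (2 - 2 * \<sigma>) * (1 + ln T)))"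
      using C(2)[OF T] by (intro mult_left_mono) (auto simp: h_def)
    also have "\<dots> = C * ((T powr (- \<epsilon>) * T powr (2 - 2 * \<sigma>)) * (1 + ln T))" by (simp only: mult_ac)
    also have "T powr (- \<epsilon>) * T powr (2 - 2 * \<sigma>) = T powr (2 - 2 * \<sigma> - \<epsilon>)"
      by (simp add: powr_add[symmetric])
    finally have part2: "integral {R..T} g \<le> C * (T powr (2 - 2 * \<sigma> - \<epsilon>) * (1 + ln T))" .
    have "1 + ln T \<le> (1 + 1 / \<epsilon>) * T powr \<epsilon>"
      using ln_powr_bound[OF T \<epsilon>(1)] ge_one_powr_ge_zero[of T \<epsilon>] T \<epsilon> by (simp add: algebra_simps)
    then have "T powr (2 - 2 * \<sigma> - \<epsilon>) * (1 + ln T) \<le> T powr (2 - 2 * \<sigma> - \<epsilon>) * ((1 + 1 / \<epsilon>) * T powr \<epsilon>)"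
      by (intro mult_left_mono) auto
    also have "\<dots> = (1 + 1 / \<epsilon>) * (T powr (2 - 2 * \<sigma> - \<epsilon>) * T powr \<epsilon>)" by simp
    also have "T powr (2 - 2 * \<sigma> - \<epsilon>) * T powr \<epsilon> = T powr (2 - 2 * \<sigma>)"
      by (simp add: powr_add[symmetric])
    finally have "2 * (C * (T powr (2 - 2 * \<sigma> - \<epsilon>) * (1 + ln T))) \<le> 2 * (C * ((1 + 1 / \<epsilon>) * T powr (2 - 2 * \<sigma>)))"
      using C by (intro mult_left_mono) auto
    then have "weighted_mean_square \<sigma> T \<le> 2 * (C * ((1 + 1 / \<epsilon>) * T powr (2 - 2 * \<sigma>)))"
      using split part1 part2 by linarith
    then show ?thesis by (simp only: mult_ac)
  qed
  then show thesis using that[of "C * 2 * (1 + 1 / \<epsilon>)"] C(1) \<epsilon>(1) by (simp add: add_pos_pos)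
qed

section \<open>From the mean square to the integral\<close>

text \<open>
  The exponentials \<open>e\<^sup>-\<^sup>\<pi>\<^sup>(\<^sup>t\<^sup>-\<^sup>s\<^sup>)\<^sup>/\<^sup>2\<close>, \<open>e\<^sup>-\<^sup>\<pi>\<^sup>s\<^sup>/\<^sup>2\<close> and \<open>e\<^sup>\<pi>\<^sup>t\<^sup>/\<^sup>2\<close> cancel, and \<open>t - s \<ge> t/2\<close> allows replacing the power of
  \<open>t - s\<close> by one of \<open>t\<close>.
\<close>

lemma Gamma_ratio_bound:
  assumes \<sigma>: "0 < \<sigma>" "\<sigma> < 1"
  obtains D where "D > 0" "\<And>t s. t \<ge> 2 \<Longrightarrow> 1 \<le> s \<Longrightarrow> s \<le> t / 2 \<Longrightarrow>
    cmod (Gamma (Complex 0 (t - s)) / Gamma (Complex \<sigma> t) * Gamma (Complex \<sigma> s))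
      \<le> D * (t powr (- \<sigma>) * s powr (\<sigma> - 1 / 2))"
proof -
  obtain C where C: "C > 0"
    and up: "\<And>x y. 0 < x \<Longrightarrow> x < 1 \<Longrightarrow> y \<ge> 1 \<Longrightarrow>
      cmod (Gamma (Complex x y)) \<le> C * (y powr (x - 1 / 2) * exp (- pi * y / 2))"
    and low: "\<And>x y. 0 < x \<Longrightarrow> x < 1 \<Longrightarrow> y \<ge> 1 \<Longrightarrow>
      inverse (cmod (Gamma (Complex x y))) \<le> C * (y powr (1 / 2 - x) * exp (pi * y / 2))"
    using Gamma_vertical_bounds by metis
  have "cmod (Gamma (Complex 0 (t - s)) / Gamma (Complex \<sigma> t) * Gamma (Complex \<sigma> s))
      \<le> 8 * C\<^sup>2 * (t powr (- \<sigma>) * s powr (\<sigma> - 1 / 2))" if t: "t \<ge> 2" and s: "1 \<le> s" "s \<le> t / 2" for t s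
  proof -
    have ts: "t - s \<ge> t / 2" "t - s \<ge> 1" using s t by auto
    have "(t - s) powr (- 1 / 2) \<le> (t / 2) powr (- 1 / 2)"
      using ts t by (intro powr_mono2') auto
    also have "\<dots> = 2 powr (1 / 2) * t powr (- 1 / 2)"
      using t by (simp add: powr_divide powr_minus field_simps)
    also have "2 powr (1 / 2) \<le> (2 :: real) powr 1" by (intro powr_mono) auto
    finally have half: "(t - s) powr (- 1 / 2) \<le> 2 * t powr (- 1 / 2)" by (simp add: mult_right_mono)
    have "cmod (Gamma (Complex 0 (t - s)) / Gamma (Complex \<sigma> t) * Gamma (Complex \<sigma> s))
        = cmod (Gamma (Complex 0 (t - s))) * inverse (cmod (Gamma (Complex \<sigma> t))) * cmod (Gamma (Complex \<sigma> s))"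
      by (simp add: norm_mult norm_inverse divide_inverse)
    also have "\<dots> \<le> (4 * ((2 * t powr (- 1 / 2)) * exp (- pi * (t - s) / 2)))
        * (C * (t powr (1 / 2 - \<sigma>) * exp (pi * t / 2))) * (C * (s powr (\<sigma> - 1 / 2) * exp (- pi * s / 2)))"
    proof (intro mult_mono up low \<sigma>)
      have "cmod (Gamma (Complex 0 (t - s))) \<le> 4 * ((t - s) powr (- 1 / 2) * exp (- pi * (t - s) / 2))"
        by (rule Gamma_imaginary_le[OF ts(2)])
      also have "\<dots> \<le> 4 * ((2 * t powr (- 1 / 2)) * exp (- pi * (t - s) / 2))"
        using half by (intro mult_left_mono mult_right_mono) auto
      finally show "cmod (Gamma (Complex 0 (t - s))) \<le> 4 * ((2 * t powr (- 1 / 2)) * exp (- pi * (t - s) / 2))" .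
    qed (use t s C in auto)
    also have "\<dots> = 8 * C\<^sup>2 * (t powr (- 1 / 2) * t powr (1 / 2 - \<sigma>)) * s powr (\<sigma> - 1 / 2)
        * (exp (- pi * (t - s) / 2) * exp (pi * t / 2) * exp (- pi * s / 2))"
      by (simp add: power2_eq_square)
    also have "exp (- pi * (t - s) / 2) * exp (pi * t / 2) * exp (- pi * s / 2) = 1"
      unfolding exp_add[symmetric] by (simp add: field_simps)
    also have "t powr (- 1 / 2) * t powr (1 / 2 - \<sigma>) = t powr (- \<sigma>)"
      by (simp add: powr_add[symmetric])
    finally show ?thesis by (simp add: mult_ac)
  qed
  then show thesis using that[of "8 * C\<^sup>2"] C by simp
qed

text \<open>
  The absolute value of the integrand is integrated after the substitution \<open>s = t\<tau>\<close>. The upper end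
  \<open>t\<^sup>\<delta>\<close> of the new range is at most \<open>t/2\<close> for large \<open>t\<close>, as the bound for the Gamma quotient requires.
\<close>

lemma I2_le_weighted_mean_square:
  assumes \<sigma>: "0 < \<sigma>" "\<sigma> < 1" and \<delta>: "0 < \<delta>" "\<delta> < 1"
  obtains D where "D > 0"
    "\<forall>\<^sub>F t in at_top. \<bar>I2 \<sigma> t \<delta>\<bar> \<le> D * (t powr (- \<sigma>) * weighted_mean_square \<sigma> (t powr \<delta>))"
proof -
  obtain D where D: "D > 0" and G: "\<And>t s. t \<ge> 2 \<Longrightarrow> 1 \<le> s \<Longrightarrow> s \<le> t / 2 \<Longrightarrow>
    cmod (Gamma (Complex 0 (t - s)) / Gamma (Complex \<sigma> t) * Gamma (Complex \<sigma> s))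
      \<le> D * (t powr (- \<sigma>) * s powr (\<sigma> - 1 / 2))"
    using Gamma_ratio_bound[OF \<sigma>] by metis
  have "((\<lambda>t. t powr (\<delta> - 1)) \<longlongrightarrow> (0::real)) at_top"
    using \<delta> by (intro tendsto_neg_powr filterlim_ident) auto
  then have "\<forall>\<^sub>F t in at_top. t powr (\<delta> - 1) < (1 / 2 :: real)"
    by (rule order_tendstoD) simp
  then have "\<forall>\<^sub>F t in at_top. \<bar>I2 \<sigma> t \<delta>\<bar> \<le> D / pi * (t powr (- \<sigma>) * weighted_mean_square \<sigma> (t powr \<delta>))"
    using eventually_ge_at_top[of 2]
  proof eventually_elim
    case (elim t)
    then have t: "t \<ge> 2" and small: "t powr (\<delta> - 1) < 1 / 2" by auto
    define b where "b = t powr (\<delta> - 1)"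
    define g where "g = (\<lambda>y. y powr (\<sigma> - 1 / 2) * (cmod (zeta (Complex \<sigma> y)))\<^sup>2)"
    define f where "f = (\<lambda>\<tau>. Re (Gamma (\<i> * of_real t - \<i> * of_real t * of_real \<tau>) / Gamma (of_real \<sigma> + \<i> * of_real t)
            * Gamma (of_real \<sigma> + \<i> * of_real t * of_real \<tau>))
        * (cmod (zeta (of_real \<sigma> + \<i> * of_real t * of_real \<tau>)))\<^sup>2)"
    have tb: "t * b = t powr \<delta>" using t powr_add[of t 1 "\<delta> - 1"] by (simp add: b_def)
    have "1 \<le> t powr \<delta>" using t \<delta> by (simp add: ge_one_powr_ge_zero)
    then have ab: "1 / t \<le> b" using t tb by (simp add: field_simps)
    have bound: "\<bar>f \<tau>\<bar> \<le> D * t powr (- \<sigma>) * g (t * \<tau>)" if \<tau>: "\<tau> \<in> {1 / t..b}" for \<tau>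
    proof -
      define s where "s = t * \<tau>"
      have "1 \<le> s" using \<tau> t by (simp add: s_def field_simps)
      moreover have "s \<le> t / 2"
      proof -
        have "\<tau> \<le> 1 / 2" using \<tau> small by (simp add: b_def)
        then have "t * \<tau> \<le> t * (1 / 2)" using t by (intro mult_left_mono) auto
        then show ?thesis by (simp add: s_def)
      qed
      ultimately have le: "cmod (Gamma (Complex 0 (t - s)) / Gamma (Complex \<sigma> t) * Gamma (Complex \<sigma> s))
          \<le> D * (t powr (- \<sigma>) * s powr (\<sigma> - 1 / 2))"
        by (rule G[OF t])
      have eqs: "\<i> * of_real t - \<i> * of_real t * of_real \<tau> = Complex 0 (t - s)"
        "of_real \<sigma> + \<i> * of_real t = Complex \<sigma> t"
        "of_real \<sigma> + \<i> * of_real t * of_real \<tau> = Complex \<sigma> s"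
        by (auto simp: complex_eq_iff s_def)
      have "\<bar>f \<tau>\<bar> = \<bar>Re (Gamma (Complex 0 (t - s)) / Gamma (Complex \<sigma> t) * Gamma (Complex \<sigma> s))\<bar>
          * (cmod (zeta (Complex \<sigma> s)))\<^sup>2"
        unfolding f_def eqs by (simp add: abs_mult)
      also have "\<dots> \<le> (D * (t powr (- \<sigma>) * s powr (\<sigma> - 1 / 2))) * (cmod (zeta (Complex \<sigma> s)))\<^sup>2"
        by (intro mult_right_mono order_trans[OF abs_Re_le_cmod le]) auto
      finally show ?thesis by (simp add: g_def s_def mult_ac)
    qed
    have gc: "continuous_on {1..t powr \<delta>} g"
      unfolding g_def by (rule weighted_integrand_continuous) (use \<sigma> in auto)
    have "(g has_integral weighted_mean_square \<sigma> (t powr \<delta>)) (cbox 1 (t powr \<delta>))"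
      unfolding weighted_mean_square_def g_def[symmetric]
      using integrable_integral[OF integrable_continuous_interval[OF gc]] by simp
    moreover have "b = inverse t * t powr \<delta>" using t tb[symmetric] by simp
    ultimately have gi: "((\<lambda>\<tau>. g (t * \<tau>)) has_integral (weighted_mean_square \<sigma> (t powr \<delta>) / t)) {1 / t..b}"
      using has_integral_affinity'[of g "weighted_mean_square \<sigma> (t powr \<delta>)" 1 "t powr \<delta>" t 0] t
      by (simp add: divide_inverse mult.commute)
    have gtc: "continuous_on {1 / t..b} (\<lambda>\<tau>. D * t powr (- \<sigma>) * g (t * \<tau>))"
    proof (intro continuous_intros continuous_on_compose2[OF gc])
      show "(*) t ` {1 / t..b} \<subseteq> {1..t powr \<delta>}"
      proof clarify
        fix \<tau> assume "\<tau> \<in> {1 / t..b}"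
        then have "t * (1 / t) \<le> t * \<tau>" "t * \<tau> \<le> t * b"
          using t mult_left_mono[of "1 / t" \<tau> t] mult_left_mono[of \<tau> b t] by auto
        then show "t * \<tau> \<in> {1..t powr \<delta>}" using t tb by simp
      qed
    qed
    have si: "set_integrable lborel {1 / t..b} (\<lambda>\<tau>. D * t powr (- \<sigma>) * g (t * \<tau>))"
      by (rule borel_integrable_atLeastAtMost'[OF gtc])
    have g0: "g y \<ge> 0" for y by (simp add: g_def)
    have "\<bar>LBINT \<tau>=ereal (1 / t)..ereal b. f \<tau>\<bar> = \<bar>LBINT \<tau>:{1 / t..b}. f \<tau>\<bar>"
      using interval_integral_Icc[OF ab, of f] by simp
    also have "\<dots> \<le> (\<integral>\<tau>. norm (indicator {1 / t..b} \<tau> *\<^sub>R f \<tau>) \<partial>lborel)"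
      unfolding set_lebesgue_integral_def using integral_norm_bound by (metis real_norm_def)
    also have "\<dots> \<le> (LBINT \<tau>:{1 / t..b}. D * t powr (- \<sigma>) * g (t * \<tau>))"
      unfolding set_lebesgue_integral_def
    proof (rule integral_mono')
      show "integrable lborel (\<lambda>\<tau>. indicator {1 / t..b} \<tau> *\<^sub>R (D * t powr (- \<sigma>) * g (t * \<tau>)))"
        using si by (simp add: set_integrable_def)
      fix \<tau>
      show "norm (indicator {1 / t..b} \<tau> *\<^sub>R f \<tau>) \<le> indicator {1 / t..b} \<tau> *\<^sub>R (D * t powr (- \<sigma>) * g (t * \<tau>))"
        using bound[of \<tau>] by (simp add: indicator_def)
      show "0 \<le> indicator {1 / t..b} \<tau> *\<^sub>R (D * t powr (- \<sigma>) * g (t * \<tau>))"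
        using D g0 by (simp add: indicator_def)
    qed
    also have "\<dots> = integral {1 / t..b} (\<lambda>\<tau>. D * t powr (- \<sigma>) * g (t * \<tau>))"
      by (rule set_borel_integral_eq_integral[OF si])
    also have "\<dots> = D * t powr (- \<sigma>) * (weighted_mean_square \<sigma> (t powr \<delta>) / t)"
      using integral_unique[OF gi] by simp
    finally have le: "\<bar>LBINT \<tau>=ereal (1 / t)..ereal b. f \<tau>\<bar>
        \<le> D * t powr (- \<sigma>) * (weighted_mean_square \<sigma> (t powr \<delta>) / t)" .
    have "I2 \<sigma> t \<delta> = t / pi * (LBINT \<tau>=ereal (1 / t)..ereal b. f \<tau>)"
      by (simp add: I2_def f_def b_def)
    then have "\<bar>I2 \<sigma> t \<delta>\<bar> = t / pi * \<bar>LBINT \<tau>=ereal (1 / t)..ereal b. f \<tau>\<bar>"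
      using t by (simp add: abs_mult)
    also have "\<dots> \<le> t / pi * (D * t powr (- \<sigma>) * (weighted_mean_square \<sigma> (t powr \<delta>) / t))"
      using le t by (intro mult_left_mono) auto
    also have "\<dots> = D / pi * (t powr (- \<sigma>) * weighted_mean_square \<sigma> (t powr \<delta>))"
      using t by simp
    finally show ?case .
  qed
  then show thesis using that[of "D / pi"] D by simp
qed

lemma I2_bigo_of_weighted_bound:
  assumes \<sigma>: "0 < \<sigma>" "\<sigma> < 1" and \<delta>: "0 < \<delta>" "\<delta> < 1"
    and C: "C > 0" "\<And>T. T \<ge> 1 \<Longrightarrow> weighted_mean_square \<sigma> T \<le> C * h T"
  shows "(\<lambda>t. I2 \<sigma> t \<delta>) \<in> O[at_top](\<lambda>t. t powr (- \<sigma>) * h (t powr \<delta>))"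
proof -
  obtain D where D: "D > 0"
    "\<forall>\<^sub>F t in at_top. \<bar>I2 \<sigma> t \<delta>\<bar> \<le> D * (t powr (- \<sigma>) * weighted_mean_square \<sigma> (t powr \<delta>))"
    using I2_le_weighted_mean_square[OF \<sigma> \<delta>] by blast
  show ?thesis
  proof (rule bigoI[of _ "D * C"])
    show "\<forall>\<^sub>F t in at_top. norm (I2 \<sigma> t \<delta>) \<le> D * C * norm (t powr (- \<sigma>) * h (t powr \<delta>))"
      using D(2) eventually_ge_at_top[of 1]
    proof eventually_elim
      case (elim t)
      have "t powr \<delta> \<ge> 1" using elim \<delta> by (simp add: ge_one_powr_ge_zero)
      then have "weighted_mean_square \<sigma> (t powr \<delta>) \<le> C * h (t powr \<delta>)" by (rule C(2))
      also have "\<dots> \<le> C * \<bar>h (t powr \<delta>)\<bar>" using C by (intro mult_left_mono) auto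
      finally have "D * (t powr (- \<sigma>) * weighted_mean_square \<sigma> (t powr \<delta>))
          \<le> D * (t powr (- \<sigma>) * (C * \<bar>h (t powr \<delta>)\<bar>))"
        using D by (intro mult_left_mono) auto
      then show ?case using elim(1) by (simp add: abs_mult mult_ac)
    qed
  qed
qed

theorem lemma4p2:
  fixes \<delta>\<^sub>2 :: real
  assumes "0 < \<delta>\<^sub>2" and "\<delta>\<^sub>2 < 1"
  shows "(\<lambda>t. I2 (1 / 2) t \<delta>\<^sub>2) \<in> O[at_top](\<lambda>t. t powr (- 1 / 2 + \<delta>\<^sub>2) * ln t) \<and>
    (\<forall>\<sigma>::real. 1 / 2 < \<sigma> \<and> \<sigma> < 1 \<longrightarrow>
       (\<lambda>t. I2 \<sigma> t \<delta>\<^sub>2) \<in> O[at_top](\<lambda>t. t powr (- \<sigma> + (\<sigma> + 1 / 2) * \<delta>\<^sub>2) * Re (zeta (of_real (2 * \<sigma>))))) \<and>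
    (\<forall>\<sigma>::real. 0 < \<sigma> \<and> \<sigma> < 1 / 2 \<longrightarrow>
       (\<lambda>t. I2 \<sigma> t \<delta>\<^sub>2) \<in> O[at_top](\<lambda>t. t powr (- \<sigma> + 2 * (1 - \<sigma>) * \<delta>\<^sub>2) * Re (zeta (of_real (2 - 2 * \<sigma>)))))"
proof (intro conjI allI impI)
  note \<delta> = assms
  show "(\<lambda>t. I2 (1 / 2) t \<delta>\<^sub>2) \<in> O[at_top](\<lambda>t. t powr (- 1 / 2 + \<delta>\<^sub>2) * ln t)"
  proof -
    obtain C where C: "C > 0" "\<And>T. T \<ge> 1 \<Longrightarrow> weighted_mean_square (1 / 2) T \<le> C * (T * (1 + ln T))"
      using weighted_mean_square_half by blast
    have "(\<lambda>t. I2 (1 / 2) t \<delta>\<^sub>2) \<in> O[at_top](\<lambda>t. t powr (- (1 / 2)) * (t powr \<delta>\<^sub>2 * (1 + ln (t powr \<delta>\<^sub>2))))"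
      by (rule I2_bigo_of_weighted_bound[OF _ _ \<delta> C]) auto
    also have "(\<lambda>t. t powr (- (1 / 2)) * (t powr \<delta>\<^sub>2 * (1 + ln (t powr \<delta>\<^sub>2))))
        \<in> O[at_top](\<lambda>t. t powr (- 1 / 2 + \<delta>\<^sub>2) * ln t)"
    proof (rule bigoI[of _ 2])
      show "\<forall>\<^sub>F t in at_top. norm (t powr (- (1 / 2)) * (t powr \<delta>\<^sub>2 * (1 + ln (t powr \<delta>\<^sub>2))))
          \<le> 2 * norm (t powr (- 1 / 2 + \<delta>\<^sub>2) * ln t)"
        using eventually_ge_at_top[of "exp 1"]
      proof eventually_elim
        case (elim t)
        have t: "t > 0" using elim exp_gt_zero[of 1] by linarith
        then have l: "ln t \<ge> 1" using elim by (simp add: ln_ge_iff)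
        have "t powr (- (1 / 2)) * t powr \<delta>\<^sub>2 = t powr (- 1 / 2 + \<delta>\<^sub>2)"
          by (simp add: powr_add[symmetric])
        then have eq: "t powr (- (1 / 2)) * (t powr \<delta>\<^sub>2 * (1 + ln (t powr \<delta>\<^sub>2))) = t powr (- 1 / 2 + \<delta>\<^sub>2) * (1 + \<delta>\<^sub>2 * ln t)"
          using t by (simp only: ln_powr mult.assoc[symmetric])
        have "\<delta>\<^sub>2 * ln t \<le> 1 * ln t" using l \<delta> by (intro mult_right_mono) auto
        then have "1 + \<delta>\<^sub>2 * ln t \<le> 2 * ln t" using l by linarith
        moreover have "0 \<le> \<delta>\<^sub>2 * ln t" using l \<delta> by simp
        ultimately have "\<bar>1 + \<delta>\<^sub>2 * ln t\<bar> \<le> 2 * \<bar>ln t\<bar>" by linarith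
        then have "t powr (- 1 / 2 + \<delta>\<^sub>2) * \<bar>1 + \<delta>\<^sub>2 * ln t\<bar> \<le> t powr (- 1 / 2 + \<delta>\<^sub>2) * (2 * \<bar>ln t\<bar>)"
          by (intro mult_left_mono) auto
        then show ?case unfolding eq by (simp add: abs_mult)
      qed
    qed
    finally show ?thesis .
  qed
next
  fix \<sigma> :: real assume \<sigma>: "1 / 2 < \<sigma> \<and> \<sigma> < 1"
  obtain C where C: "C > 0" "\<And>T. T \<ge> 1 \<Longrightarrow> weighted_mean_square \<sigma> T \<le> C * T powr (\<sigma> + 1 / 2)"
    using weighted_mean_square_right[of \<sigma>] \<sigma> by blast
  have "(\<lambda>t. I2 \<sigma> t \<delta>\<^sub>2) \<in> O[at_top](\<lambda>t. t powr (- \<sigma>) * (t powr \<delta>\<^sub>2) powr (\<sigma> + 1 / 2))"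
    by (rule I2_bigo_of_weighted_bound[OF _ _ assms C]) (use \<sigma> in auto)
  also have "(\<lambda>t. t powr (- \<sigma>) * (t powr \<delta>\<^sub>2) powr (\<sigma> + 1 / 2)) = (\<lambda>t. t powr (- \<sigma> + (\<sigma> + 1 / 2) * \<delta>\<^sub>2))"
    by (simp add: powr_powr powr_add[symmetric] mult.commute)
  finally show "(\<lambda>t. I2 \<sigma> t \<delta>\<^sub>2) \<in> O[at_top](\<lambda>t. t powr (- \<sigma> + (\<sigma> + 1 / 2) * \<delta>\<^sub>2) * Re (zeta (of_real (2 * \<sigma>))))"
    using Re_zeta_of_real_pos[of "2 * \<sigma>"] \<sigma> by simp
next
  fix \<sigma> :: real assume \<sigma>: "0 < \<sigma> \<and> \<sigma> < 1 / 2"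
  obtain C where C: "C > 0" "\<And>T. T \<ge> 1 \<Longrightarrow> weighted_mean_square \<sigma> T \<le> C * T powr (2 - 2 * \<sigma>)"
    using weighted_mean_square_left[of \<sigma>] \<sigma> by blast
  have "(\<lambda>t. I2 \<sigma> t \<delta>\<^sub>2) \<in> O[at_top](\<lambda>t. t powr (- \<sigma>) * (t powr \<delta>\<^sub>2) powr (2 - 2 * \<sigma>))"
    by (rule I2_bigo_of_weighted_bound[OF _ _ assms C]) (use \<sigma> in auto)
  also have "(\<lambda>t. t powr (- \<sigma>) * (t powr \<delta>\<^sub>2) powr (2 - 2 * \<sigma>)) = (\<lambda>t. t powr (- \<sigma> + 2 * (1 - \<sigma>) * \<delta>\<^sub>2))"
    by (simp add: powr_powr powr_add[symmetric] algebra_simps)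
  finally show "(\<lambda>t. I2 \<sigma> t \<delta>\<^sub>2) \<in> O[at_top](\<lambda>t. t powr (- \<sigma> + 2 * (1 - \<sigma>) * \<delta>\<^sub>2) * Re (zeta (of_real (2 - 2 * \<sigma>))))"
    using Re_zeta_of_real_pos[of "2 - 2 * \<sigma>"] \<sigma> by simp
qed

end
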